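(* Let $t$ be a positive integer. The existence of the following are equivalent: (a) a symmetric Seidel matrix with characteristic polynomial $(x^2-4t-1)^{2t+1}$; (b) a symmetric Seidel matrix with characteristic polynomial $x(x^2-4t-1)^{2t}$; (c) a symmetric Seidel matrix with characteristic polynomial $(x^2-1)(x^2-4t-1)^{2t-1}$; (d) a symmetric Seidel matrix with characteristic polynomial $(x-2)(x+1)^2(x^2-4t-1)^{2(t-1)}$.
   Context: A Seidel matrix is a square $\{0,\pm1\}$-matrix $S$ with zero diagonal, all off-diagonal entries nonzero, and $S=\pm S^\top$; it is symmetric if $S^\top=S$. The characteristic polynomial of $S$ is $\det(xI-S)$. *)

theory Defs
  imports "Jordan_Normal_Form.Char_Poly"
begin

definition seidel_mat :: "int mat \<Rightarrow> bool" where
  "seidel_mat S \<longleftrightarrow>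
     square_mat S \<and>
     (\<forall>i < dim_row S. \<forall>j < dim_row S. S $$ (i, j) \<in> {0, 1, -1}) \<and>
     (\<forall>i < dim_row S. S $$ (i, i) = 0) \<and>
     (\<forall>i < dim_row S. \<forall>j < dim_row S. i \<noteq> j \<longrightarrow> S $$ (i, j) \<noteq> 0) \<and>
     (S = transpose_mat S \<or> S = - transpose_mat S)"

definition symmetric_seidel_mat :: "int mat \<Rightarrow> bool" where
  "symmetric_seidel_mat S \<longleftrightarrow> seidel_mat S \<and> transpose_mat S = S"

end

theory Submission
  imports Defs "Jordan_Normal_Form.Schur_Decomposition"
begin

text \<open>Put \<open>m = 4t + 1\<close>. A matrix as in (a) satisfies \<open>S\<^sup>2 = mI\<close>, so \<open>(xI - S)(xI + S) = (x\<^sup>2 - m)I\<close> and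
  Jacobi's complementary minor formula gives the characteristic polynomial of \<open>S\<close> with \<open>k\<close> rows and
  columns deleted in terms of that of the deleted \<open>k \<times> k\<close> corner. Deleting one, two or three of
  them yields (b), (c), (d); for (d) one may have to replace \<open>S\<close> by \<open>-S\<close>.

  Conversely, let \<open>B\<close> be as in (b), (c) or (d) and \<open>P = mI - B\<^sup>2\<close>. This is an integer matrix of rank
  \<open>k = 1, 2, 3\<close> with all diagonal entries equal to \<open>k\<close> and off-diagonal entries of known parity. These
  constraints force \<open>P = C C\<^sup>T\<close> with \<open>C\<close> an \<open>n \<times> k\<close> matrix of signs, and \<open>BC = -CD\<close> for a symmetric Seidel
  matrix \<open>D\<close> of order \<open>k\<close>. Bordering \<open>B\<close> by \<open>C\<close> and \<open>D\<close> then gives a matrix with square \<open>mI\<close>, and the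
  same determinant formula, read backwards, gives its characteristic polynomial.\<close>

section \<open>Spectral decomposition of real symmetric matrices\<close>

text \<open>The order is \<open>n = 4t + 2 - k\<close>, so the diagonal \<open>m - (n - 1)\<close>
  of \<open>P\<close> counts the missing vertices \<open>k\<close>. A characteristic polynomial
  alone gives Cayley-Hamilton with multiplicities; it is real diagonalizability of symmetric
  matrices that lets an identity between integer polynomials in \<open>B\<close> be checked on the
  distinct eigenvalues, and that turns \<open>(x^2 - m)^(2t+1)\<close> into \<open>S^2 = mI\<close>.
  The obstacle in the converse is that \<open>P\<close> determines a factor \<open>C\<close> only up
  to a real orthogonal change of coordinates, whereas the new columns must consist of signs. For
  \<open>k = 1\<close> and \<open>k = 2\<close> the nonzero eigenvalues of \<open>P\<close> are all
  equal (\<open>m\<close>, respectively \<open>4t\<close> twice), so \<open>P\<close> is a multiple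
  of a projection, and Cauchy-Schwarz between its rows together with integrality and parity pins the
  entries down. For \<open>k = 3\<close> the nonzero eigenvalues are \<open>4t, 4t, 4t - 3\<close>;
  one temporary extra index restores a multiple of a projection. The change of sign in (d) is due to
  the deleted corner: for order three its characteristic polynomial depends on the product of its
  three entries above the diagonal, for orders one and two it is always the same.\<close>

lemma orthogonal_matrix_with_first_column:
  fixes v :: "real vec"
  assumes v: "v \<in> carrier_vec n" and v0: "v \<noteq> 0\<^sub>v n"
  obtains W c where "W \<in> carrier_mat n n" "transpose_mat W * W = 1\<^sub>m n" "col W 0 = c \<cdot>\<^sub>v v"
proof -
  interpret cof_vec_space n "TYPE(real)" .
  define b where "b = basis_completion v"
  define ws where "ws = gram_schmidt n b"
  have n: "n \<noteq> 0" using v v0 by (metis carrier_vecD eq_vecI index_zero_vec(2) less_nat_zero_code)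
  from basis_completion[OF v v0, folded b_def]
  have dist_b: "distinct b" and indep: "\<not> lin_dep (set b)" and b: "set b \<subseteq> carrier_vec n"
    and hdb: "hd b = v" and len_b: "length b = n" by auto
  from hdb len_b n obtain vs where bv: "b = v # vs" by (cases b, auto)
  from gram_schmidt_result[OF b dist_b indep refl, folded ws_def]
  have ws: "set ws \<subseteq> carrier_vec n" "corthogonal ws" "length ws = n" by (auto simp: len_b)
  from gram_schmidt_hd[OF v, of vs, folded bv] have hdws: "hd ws = v" unfolding ws_def .
  have ws0: "ws ! 0 = v" using hdws ws(3) n by (cases ws, auto)
  have wsi: "ws ! i \<in> carrier_vec n" if "i < n" for i using that ws by auto
  have orth: "(ws ! i \<bullet> ws ! j = 0) = (i \<noteq> j)" if "i < n" "j < n" for i j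
    using corthogonalD[OF ws(2), of i j] that ws(3) by simp
  have pos: "ws ! i \<bullet> ws ! i > 0" if "i < n" for i
    using orth[OF that that] by (auto simp: scalar_prod_def less_le intro!: sum_nonneg)
  define q where "q i = 1 / sqrt (ws ! i \<bullet> ws ! i)" for i
  define W where "W = mat_of_cols n (map (\<lambda>i. q i \<cdot>\<^sub>v ws ! i) [0..<n])"
  have W: "W \<in> carrier_mat n n"
    unfolding W_def using mat_of_cols_carrier(1)[of n "map (\<lambda>i. q i \<cdot>\<^sub>v ws ! i) [0..<n]"] by simp
  have colW: "col W i = q i \<cdot>\<^sub>v ws ! i" if "i < n" for i
    unfolding W_def using that wsi[OF that] by (subst col_mat_of_cols) auto
  have "transpose_mat W * W = 1\<^sub>m n"
  proof (rule eq_matI)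
    fix i j assume "i < dim_row (1\<^sub>m n :: real mat)" "j < dim_col (1\<^sub>m n :: real mat)"
    hence i: "i < n" and j: "j < n" by auto
    have "(transpose_mat W * W) $$ (i,j) = (q i \<cdot>\<^sub>v ws ! i) \<bullet> (q j \<cdot>\<^sub>v ws ! j)"
      using W i j colW by simp
    also have "\<dots> = q i * (q j * (ws ! i \<bullet> ws ! j))"
      using wsi[OF i] wsi[OF j] by simp
    also have "\<dots> = 1\<^sub>m n $$ (i,j)"
      using orth[OF i j] pos[OF i] i j by (auto simp: q_def)
    finally show "(transpose_mat W * W) $$ (i,j) = 1\<^sub>m n $$ (i,j)" .
  qed (use W in auto)
  moreover have "col W 0 = q 0 \<cdot>\<^sub>v v" using colW[of 0] ws0 n by simp
  ultimately show thesis using that W by blast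
qed

text \<open>Deflation: conjugating by an orthogonal matrix whose first column is an eigenvector
  clears the first column below the diagonal, and by symmetry also the first row, so a smaller
  symmetric matrix with the remaining roots splits off. The diagonal follows the order of
  \<open>es\<close>, which later allows the exceptional eigenvalues to be addressed by
  index.\<close>

lemma real_symmetric_diagonalization:
  fixes A :: "real mat"
  assumes "A \<in> carrier_mat n n" "transpose_mat A = A"
    and "char_poly A = (\<Prod>e \<leftarrow> es. [:- e, 1:])"
  shows "\<exists>U \<in> carrier_mat n n. transpose_mat U * U = 1\<^sub>m n
    \<and> transpose_mat U * A * U = mat n n (\<lambda>(i,j). if i = j then es ! i else 0)"
  using assms
proof (induction es arbitrary: n A)
  case Nil
  hence "n = 0" using degree_monic_char_poly[of A n] by auto
  thus ?case using Nil by (intro bexI[of _ "1\<^sub>m 0"] conjI eq_matI) auto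
next
  case (Cons e es n A)
  note A = Cons.prems(1) and sym = Cons.prems(2)
  let ?p = "\<Prod>e \<leftarrow> es. [:- e, 1:]"
  have cp: "char_poly A = [:-e, 1:] * ?p" using Cons.prems by simp
  have "monic ?p" by (rule monic_prod_list, auto)
  hence "degree (char_poly A) = Suc (degree ?p)"
    unfolding cp by (subst degree_mult_eq) auto
  then obtain k where n: "n = Suc k" using degree_monic_char_poly[OF A] by auto
  have "eigenvalue A e" unfolding eigenvalue_root_char_poly[OF A] cp by simp
  then obtain v where v: "v \<in> carrier_vec n" "v \<noteq> 0\<^sub>v n" "A *\<^sub>v v = e \<cdot>\<^sub>v v"
    using A unfolding eigenvalue_def eigenvector_def by auto
  obtain W c where W: "W \<in> carrier_mat n n" and WW: "transpose_mat W * W = 1\<^sub>m n"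
    and W0: "col W 0 = c \<cdot>\<^sub>v v"
    using orthogonal_matrix_with_first_column[OF v(1,2)] by blast
  have Wt: "transpose_mat W \<in> carrier_mat n n" using W by simp
  have WW': "W * transpose_mat W = 1\<^sub>m n" by (rule mat_mult_left_right_inverse[OF Wt W WW])
  define A' where "A' = transpose_mat W * A * W"
  have A': "A' \<in> carrier_mat n n" unfolding A'_def using A W by auto
  have symA': "transpose_mat A' = A'"
  proof -
    have "transpose_mat A' = transpose_mat W * (transpose_mat A * W)"
      unfolding A'_def
      using transpose_mult[OF mult_carrier_mat[OF Wt A] W] transpose_mult[OF Wt A] by simp
    thus ?thesis unfolding A'_def sym using A W by simp
  qed
  have A'_eq: "A' = transpose_mat W * (A * W)" unfolding A'_def using A W by simp
  have col0: "A' $$ (i, 0) = (if i = 0 then e else 0)" if i: "i < n" for i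
  proof -
    have "A' $$ (i, 0) = (transpose_mat W * (A * W)) $$ (i,0)" unfolding A'_eq ..
    also have "\<dots> = row (transpose_mat W) i \<bullet> col (A * W) 0"
      using i n A W by (subst index_mult_mat) auto
    also have "col (A * W) 0 = A *\<^sub>v col W 0" using A W n by auto
    also have "\<dots> = e \<cdot>\<^sub>v col W 0" using W0 v A by (simp add: mult_mat_vec smult_smult_assoc mult.commute)
    also have "row (transpose_mat W) i \<bullet> (e \<cdot>\<^sub>v col W 0) = e * (row (transpose_mat W) i \<bullet> col W 0)"
      using W i n by simp
    also have "row (transpose_mat W) i \<bullet> col W 0 = (transpose_mat W * W) $$ (i,0)"
      using W i n by simp
    finally show ?thesis unfolding WW using i n by simp
  qed
  have row0: "A' $$ (0, j) = (if j = 0 then e else 0)" if j: "j < n" for j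
  proof -
    have "A' $$ (0, j) = transpose_mat A' $$ (j, 0)" using A' j n by simp
    thus ?thesis using col0[OF j] symA' by simp
  qed
  define A3 where "A3 = mat k k (\<lambda>(i,j). A' $$ (Suc i, Suc j))"
  have A3: "A3 \<in> carrier_mat k k" unfolding A3_def by simp
  have symA3: "transpose_mat A3 = A3"
  proof (rule eq_matI)
    fix i j assume "i < dim_row A3" "j < dim_col A3"
    hence ij: "i < k" "j < k" using A3 by auto
    have "A' $$ (Suc j, Suc i) = transpose_mat A' $$ (Suc i, Suc j)" using A' ij n by simp
    thus "transpose_mat A3 $$ (i,j) = A3 $$ (i,j)" using ij symA' unfolding A3_def by simp
  qed (auto simp: A3_def)
  let ?E = "mat 1 1 (\<lambda>_. e)"
  have block: "A' = four_block_mat ?E (0\<^sub>m 1 k) (0\<^sub>m k 1) A3"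
    using A' n col0 row0 by (intro eq_matI) (auto simp: A3_def)
  have "similar_mat_wit A' A (transpose_mat W) W"
    by (rule similar_mat_witI[of _ _ n]) (use WW WW' A W A' in \<open>auto simp: A'_def\<close>)
  hence "char_poly A' = char_poly A" by (intro char_poly_similar) (auto simp: similar_mat_def)
  moreover have "char_poly A' = char_poly ?E * char_poly A3"
    unfolding block by (rule char_poly_four_block_zeros_col) (use A3 in auto)
  moreover have "char_poly ?E = [:-e, 1:]" by (simp add: char_poly_defs det_def sign_def)
  ultimately have "char_poly A3 = ?p" unfolding cp by (metis mult_cancel_left pCons_eq_0_iff zero_neq_one)
  from Cons.IH[OF A3 symA3 this] obtain U where U: "U \<in> carrier_mat k k"
    and UU: "transpose_mat U * U = 1\<^sub>m k"
    and D: "transpose_mat U * A3 * U = mat k k (\<lambda>(i,j). if i = j then es ! i else 0)" by auto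
  define V where "V = four_block_mat (1\<^sub>m 1) (0\<^sub>m 1 k) (0\<^sub>m k 1) U"
  have V: "V \<in> carrier_mat n n"
    using four_block_carrier_mat[OF one_carrier_mat U, of 1] unfolding V_def n by simp
  have Vt: "transpose_mat V = four_block_mat (1\<^sub>m 1) (0\<^sub>m 1 k) (0\<^sub>m k 1) (transpose_mat U)"
    unfolding V_def transpose_four_block_mat[OF one_carrier_mat zero_carrier_mat zero_carrier_mat U] by simp
  have mult: "four_block_mat C1 (0\<^sub>m 1 k) (0\<^sub>m k 1) M1 * four_block_mat C2 (0\<^sub>m 1 k) (0\<^sub>m k 1) M2
    = four_block_mat (C1 * C2) (0\<^sub>m 1 k) (0\<^sub>m k 1) (M1 * M2)"
    if "C1 \<in> carrier_mat 1 1" "C2 \<in> carrier_mat 1 1" "M1 \<in> carrier_mat k k" "M2 \<in> carrier_mat k k"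
    for C1 C2 M1 M2 :: "real mat"
    using mult_four_block_mat[OF that(1) zero_carrier_mat zero_carrier_mat that(3)
      that(2) zero_carrier_mat zero_carrier_mat that(4)] that by simp
  have Ut: "transpose_mat U \<in> carrier_mat k k" using U by simp
  have E: "?E \<in> carrier_mat 1 1" by simp
  have VV: "transpose_mat V * V = 1\<^sub>m n"
    unfolding Vt unfolding V_def mult[OF one_carrier_mat one_carrier_mat Ut U] UU n by simp
  have VAV: "transpose_mat V * A' * V = four_block_mat ?E (0\<^sub>m 1 k) (0\<^sub>m k 1) (transpose_mat U * A3 * U)"
    unfolding Vt block mult[OF one_carrier_mat E Ut A3]
    unfolding V_def left_mult_one_mat[OF E] mult[OF E one_carrier_mat mult_carrier_mat[OF Ut A3] U] by simp
  define X where "X = W * V"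
  have X: "X \<in> carrier_mat n n" unfolding X_def using W V by auto
  have Xt: "transpose_mat X = transpose_mat V * transpose_mat W"
    unfolding X_def by (rule transpose_mult[OF W V])
  have Vt': "transpose_mat V \<in> carrier_mat n n" using V by simp
  have "transpose_mat X * X = transpose_mat V * (transpose_mat W * W * V)"
    unfolding Xt unfolding X_def
    by (simp add: assoc_mult_mat[OF Vt' Wt mult_carrier_mat[OF W V]] assoc_mult_mat[OF Wt W V])
  hence 1: "transpose_mat X * X = 1\<^sub>m n" unfolding WW using V VV by simp
  have "transpose_mat X * A * X = transpose_mat V * A' * V"
    unfolding Xt unfolding X_def A'_def
    by (simp add: assoc_mult_mat[OF Vt' Wt A] assoc_mult_mat[OF Vt' mult_carrier_mat[OF Wt A] mult_carrier_mat[OF W V]]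
      assoc_mult_mat[OF Vt' mult_carrier_mat[OF mult_carrier_mat[OF Wt A] W] V]
      assoc_mult_mat[OF mult_carrier_mat[OF Wt A] W V])
  also have "\<dots> = mat n n (\<lambda>(i,j). if i = j then (e # es) ! i else 0)"
    unfolding VAV D n by (rule eq_matI) (auto simp: nth_Cons')
  finally show ?case using X 1 by blast
qed

text \<open>Entrywise form of \<open>B = U diag(e) U^T\<close> with \<open>U\<close> orthogonal.
  \<open>B\<close> is integer valued while \<open>U\<close> and \<open>e\<close> are real, so
  identities are computed over the reals and brought back by injectivity of
  \<open>real_of_int\<close>.\<close>

locale spectral_decomposition =
  fixes n :: nat and B :: "nat \<Rightarrow> nat \<Rightarrow> int" and U :: "nat \<Rightarrow> nat \<Rightarrow> real" and e :: "nat \<Rightarrow> real"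
  assumes orth_rows: "\<lbrakk>i < n; j < n\<rbrakk> \<Longrightarrow> (\<Sum>k<n. U i k * U j k) = (if i = j then 1 else 0)"
    and orth_cols: "\<lbrakk>i < n; j < n\<rbrakk> \<Longrightarrow> (\<Sum>k<n. U k i * U k j) = (if i = j then 1 else 0)"
    and decomp: "\<lbrakk>i < n; j < n\<rbrakk> \<Longrightarrow> real_of_int (B i j) = (\<Sum>k<n. e k * U i k * U j k)"
begin

text \<open>\<open>apply_fun f\<close> is the matrix \<open>f(B)\<close>, so that an integer matrix polynomial in \<open>B\<close> is
  determined by its values on the spectrum.\<close>

definition apply_fun :: "(real \<Rightarrow> real) \<Rightarrow> nat \<Rightarrow> nat \<Rightarrow> real" where
  "apply_fun f i j = (\<Sum>k<n. f (e k) * U i k * U j k)"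

definition represents :: "(nat \<Rightarrow> nat \<Rightarrow> int) \<Rightarrow> (real \<Rightarrow> real) \<Rightarrow> bool" where
  "represents M f \<longleftrightarrow> (\<forall>i<n. \<forall>j<n. real_of_int (M i j) = apply_fun f i j)"

lemma apply_fun_mult:
  assumes "i < n" "l < n"
  shows "(\<Sum>j<n. apply_fun f i j * apply_fun g j l) = apply_fun (\<lambda>x. f x * g x) i l"
proof -
  have "(\<Sum>j<n. apply_fun f i j * apply_fun g j l)
    = (\<Sum>j<n. \<Sum>k<n. \<Sum>k'<n. f (e k) * U i k * g (e k') * U l k' * (U j k * U j k'))"
    unfolding apply_fun_def sum_product by (intro sum.cong refl) (simp add: algebra_simps)
  also have "\<dots> = (\<Sum>k<n. \<Sum>k'<n. f (e k) * U i k * g (e k') * U l k' * (\<Sum>j<n. U j k * U j k'))"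
    by (subst sum.swap, rule sum.cong[OF refl], subst sum.swap) (simp add: sum_distrib_left)
  also have "\<dots> = (\<Sum>k<n. \<Sum>k'<n. if k = k' then f (e k) * U i k * g (e k') * U l k' else 0)"
    using orth_cols by (intro sum.cong refl) auto
  also have "\<dots> = apply_fun (\<lambda>x. f x * g x) i l"
    unfolding apply_fun_def by (intro sum.cong refl) (simp add: algebra_simps)
  finally show ?thesis .
qed

lemma represents_mult:
  assumes "represents M f" "represents N g"
  shows "represents (\<lambda>i j. \<Sum>k<n. M i k * N k j) (\<lambda>x. f x * g x)"
  using assms unfolding represents_def by (simp flip: apply_fun_mult)

lemma represents_add:
  assumes "represents M f" "represents N g"
  shows "represents (\<lambda>i j. M i j + N i j) (\<lambda>x. f x + g x)"
  using assms unfolding represents_def by (simp add: apply_fun_def algebra_simps sum.distrib)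

lemma represents_scale:
  assumes "represents M f"
  shows "represents (\<lambda>i j. c * M i j) (\<lambda>x. real_of_int c * f x)"
  using assms unfolding represents_def by (simp add: apply_fun_def algebra_simps sum_distrib_left)

lemma represents_self: "represents B (\<lambda>x. x)"
  unfolding represents_def by (simp add: decomp apply_fun_def)

lemma represents_scalar: "represents (\<lambda>i j. if i = j then c else 0) (\<lambda>x. real_of_int c)"
  unfolding represents_def
  by (simp add: apply_fun_def orth_rows mult.assoc flip: sum_distrib_left)

lemma represents_zero: "represents (\<lambda>i j. 0) (\<lambda>x. 0)"
  unfolding represents_def by (simp add: apply_fun_def)

text \<open>The device behind all matrix identities below: \<open>f\<close> and \<open>g\<close>
  need to agree only at the eigenvalues, whatever their multiplicities.\<close>

lemma represents_eqI:
  assumes "represents M f" "represents N g" "\<And>k. k < n \<Longrightarrow> f (e k) = g (e k)" "i < n" "j < n"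
  shows "M i j = N i j"
proof -
  have "apply_fun f i j = apply_fun g i j" unfolding apply_fun_def using assms(3) by simp
  hence "real_of_int (M i j) = real_of_int (N i j)" using assms unfolding represents_def by simp
  thus ?thesis by simp
qed

lemma represents_sym:
  assumes "represents M f" "i < n" "j < n"
  shows "M i j = M j i"
proof -
  have "apply_fun f i j = apply_fun f j i" unfolding apply_fun_def by (simp add: mult_ac)
  thus ?thesis using assms unfolding represents_def by (metis of_int_eq_iff)
qed

lemma trace_represents:
  assumes "represents M f"
  shows "real_of_int (\<Sum>i<n. M i i) = (\<Sum>k<n. f (e k))"
proof -
  have "real_of_int (\<Sum>i<n. M i i) = (\<Sum>i<n. \<Sum>k<n. f (e k) * (U i k * U i k))"
    using assms unfolding represents_def by (simp add: apply_fun_def mult.assoc)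
  also have "\<dots> = (\<Sum>k<n. f (e k) * (\<Sum>i<n. U i k * U i k))"
    by (subst sum.swap) (simp add: sum_distrib_left)
  also have "\<dots> = (\<Sum>k<n. f (e k))" by (simp add: orth_cols)
  finally show ?thesis .
qed

text \<open>Only the eigenvector with index 0 survives in \<open>f(B)\<close>, which is therefore a
  multiple of one outer product, and the 2 by 2 minors vanish. Index 0 is where a simple exceptional
  eigenvalue will be listed.\<close>

lemma represents_rank_one:
  assumes M: "represents M f" and f: "\<And>k. \<lbrakk>k < n; k \<noteq> 0\<rbrakk> \<Longrightarrow> f (e k) = 0"
    and ij: "i < n" "j < n" "p < n" "q < n"
  shows "M i j * M p q = M i q * M p j"
proof -
  have n: "0 < n" using ij by simp
  have eq: "real_of_int (M i j) = f (e 0) * U i 0 * U j 0" if "i < n" "j < n" for i j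
  proof -
    have "apply_fun f i j = (\<Sum>k\<in>{0}. f (e k) * U i k * U j k)"
      unfolding apply_fun_def by (rule sum.mono_neutral_right) (use f n in auto)
    thus ?thesis using M that unfolding represents_def by simp
  qed
  have "real_of_int (M i j * M p q) = real_of_int (M i q * M p j)"
    using ij by (simp add: eq mult_ac)
  thus ?thesis by (simp only: of_int_eq_iff)
qed

end

lemma spectral_decomposition_exists:
  fixes S :: "int mat"
  assumes S: "S \<in> carrier_mat n n" and sym: "transpose_mat S = S"
    and cp: "map_poly real_of_int (char_poly S) = (\<Prod>e \<leftarrow> es. [:- e, 1:])"
  shows "\<exists>U. spectral_decomposition n (\<lambda>i j. S $$ (i,j)) U (\<lambda>k. es ! k)"
proof -
  let ?A = "map_mat real_of_int S"
  have A: "?A \<in> carrier_mat n n" using S by simp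
  have symA: "transpose_mat ?A = ?A" using sym by (metis map_mat_transpose)
  have "char_poly ?A = (\<Prod>e \<leftarrow> es. [:- e, 1:])"
    using of_int_hom.char_poly_hom[OF S, where ?'a = real] cp by simp
  from real_symmetric_diagonalization[OF A symA this] obtain U where U: "U \<in> carrier_mat n n"
    and UU: "transpose_mat U * U = 1\<^sub>m n"
    and D: "transpose_mat U * ?A * U = mat n n (\<lambda>(i,j). if i = j then es ! i else 0)" by blast
  let ?D = "mat n n (\<lambda>(i,j). if i = j then es ! i else 0)"
  have Ut: "transpose_mat U \<in> carrier_mat n n" using U by simp
  have UU': "U * transpose_mat U = 1\<^sub>m n" by (rule mat_mult_left_right_inverse[OF Ut U UU])
  have "U * ?D * transpose_mat U = (U * transpose_mat U) * ?A * (U * transpose_mat U)"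
    unfolding D[symmetric]
    by (simp add: assoc_mult_mat[OF Ut A U] assoc_mult_mat[OF U Ut mult_carrier_mat[OF A mult_carrier_mat[OF U Ut]]]
      assoc_mult_mat[OF U mult_carrier_mat[OF Ut mult_carrier_mat[OF A U]] Ut]
      assoc_mult_mat[OF Ut mult_carrier_mat[OF A U] Ut] assoc_mult_mat[OF A U Ut]
      assoc_mult_mat[OF mult_carrier_mat[OF U Ut] A mult_carrier_mat[OF U Ut]])
  hence AD: "?A = U * ?D * transpose_mat U" unfolding UU' using A by simp
  have UD: "(U * ?D) $$ (i,k) = U $$ (i,k) * es ! k" if "i < n" "k < n" for i k
  proof -
    have "(U * ?D) $$ (i,k) = (\<Sum>l<n. U $$ (i,l) * (if l = k then es ! l else 0))"
      using that U by (simp add: scalar_prod_def lessThan_atLeast0)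
    also have "\<dots> = (\<Sum>l<n. if l = k then U $$ (i,k) * es ! k else 0)"
      by (intro sum.cong) auto
    finally show ?thesis using that by simp
  qed
  show ?thesis
  proof (intro exI[of _ "\<lambda>i k. U $$ (i,k)"], unfold_locales)
    fix i j assume ij: "i < n" "j < n"
    have "(U * transpose_mat U) $$ (i,j) = (\<Sum>k<n. U $$ (i,k) * U $$ (j,k))"
      using U ij by (simp add: scalar_prod_def lessThan_atLeast0)
    thus "(\<Sum>k<n. U $$ (i,k) * U $$ (j,k)) = (if i = j then 1 else 0)" using UU' ij by simp
    have "(transpose_mat U * U) $$ (i,j) = (\<Sum>k<n. U $$ (k,i) * U $$ (k,j))"
      using U ij by (simp add: scalar_prod_def lessThan_atLeast0)
    thus "(\<Sum>k<n. U $$ (k,i) * U $$ (k,j)) = (if i = j then 1 else 0)" using UU ij by simp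
    have UDc: "U * ?D \<in> carrier_mat n n" using U by simp
    have "real_of_int (S $$ (i,j)) = ?A $$ (i,j)" using S ij by simp
    also have "\<dots> = (U * ?D * transpose_mat U) $$ (i,j)" using AD by simp
    also have "\<dots> = (\<Sum>k<n. (U * ?D) $$ (i,k) * U $$ (j,k))"
      using UDc U ij by (simp add: scalar_prod_def lessThan_atLeast0 del: index_mult_mat(1) add: index_mult_mat(1)[of i "U * ?D"])
    also have "\<dots> = (\<Sum>k<n. es ! k * U $$ (i,k) * U $$ (j,k))"
      using ij by (intro sum.cong) (auto simp: UD)
    finally show "real_of_int (S $$ (i,j)) = (\<Sum>k<n. es ! k * U $$ (i,k) * U $$ (j,k))" .
  qed
qed

section \<open>Characteristic polynomials of complementary blocks\<close>

lemma char_poly_matrix_times_uminus: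
  fixes S :: "'a :: comm_ring_1 mat"
  assumes S: "S \<in> carrier_mat n n" and sq: "S * S = m \<cdot>\<^sub>m 1\<^sub>m n"
  shows "char_poly_matrix S * char_poly_matrix (- S) = [:-m, 0, 1:] \<cdot>\<^sub>m 1\<^sub>m n"
proof (rule eq_matI)
  fix i j assume "i < dim_row ([:-m, 0, 1:] \<cdot>\<^sub>m 1\<^sub>m n)" "j < dim_col ([:-m, 0, 1:] \<cdot>\<^sub>m 1\<^sub>m n)"
  hence i: "i < n" and j: "j < n" by auto
  let ?s = "\<lambda>i j. [: S $$ (i,j) :]" and ?x = "[:0, 1:] :: 'a poly"
  have sum_lift: "(\<Sum>k\<in>K. [:f k:]) = [:\<Sum>k\<in>K. f k:]" for f :: "nat \<Rightarrow> 'a" and K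
    by (induction K rule: infinite_finite_induct) auto
  have "(char_poly_matrix S * char_poly_matrix (- S)) $$ (i,j)
    = (\<Sum>k<n. ((if i = k then ?x else 0) - ?s i k) * ((if k = j then ?x else 0) + ?s k j))"
    using S i j by (auto simp: char_poly_matrix_def scalar_prod_def lessThan_atLeast0 intro!: sum.cong)
  also have "\<dots> = (\<Sum>k<n. (if i = k then ?x * ((if i = j then ?x else 0) + ?s i j) else 0)
      - (if k = j then ?s i j * ?x else 0) - [:S $$ (i,k) * S $$ (k,j):])"
    by (intro sum.cong) (auto simp: algebra_simps)
  also have "\<dots> = (if i = j then ?x * ?x else 0) - [:\<Sum>k<n. S $$ (i,k) * S $$ (k,j):]"
    using i j by (simp add: sum_subtractf sum_lift algebra_simps)
  also have "(\<Sum>k<n. S $$ (i,k) * S $$ (k,j)) = (S * S) $$ (i,j)"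
    using S i j by (simp add: scalar_prod_def lessThan_atLeast0)
  also have "\<dots> = (if i = j then m else 0)" unfolding sq using i j by simp
  finally show "(char_poly_matrix S * char_poly_matrix (- S)) $$ (i,j) = ([:-m, 0, 1:] \<cdot>\<^sub>m 1\<^sub>m n) $$ (i,j)"
    using i j by simp
qed (use S in \<open>auto simp: char_poly_matrix_def\<close>)

text \<open>Serves to replace \<open>S\<close> by \<open>- S\<close> in (d): if \<open>S\<close> has
  half of the factors of the right-hand side, then \<open>- S\<close> has the other half.\<close>

lemma char_poly_times_uminus:
  fixes S :: "'a :: idom mat"
  assumes S: "S \<in> carrier_mat n n" and sq: "S * S = m \<cdot>\<^sub>m 1\<^sub>m n"
  shows "char_poly S * char_poly (- S) = [:-m, 0, 1:] ^ n"
proof -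
  have "det (char_poly_matrix S * char_poly_matrix (- S)) = char_poly S * char_poly (- S)"
    unfolding char_poly_def by (rule det_mult[of _ n]) (use S in auto)
  thus ?thesis unfolding char_poly_matrix_times_uminus[OF S sq] by (simp add: det_smult)
qed

text \<open>Jacobi's complementary minor formula for \<open>xI - S\<close>, whose inverse is
  \<open>(xI + S) / (x\<^sup>2 - m)\<close>.\<close>

lemma char_poly_complementary_block:
  fixes B :: "'a :: idom mat"
  assumes B: "B \<in> carrier_mat n n" and C: "C \<in> carrier_mat n k"
    and C': "C' \<in> carrier_mat k n" and D: "D \<in> carrier_mat k k"
    and S: "S = four_block_mat B C C' D" and sq: "S * S = m \<cdot>\<^sub>m 1\<^sub>m (n + k)"
  shows "char_poly S * char_poly (- D) = char_poly B * [:-m, 0, 1:] ^ k"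
proof -
  \<comment> \<open>\<open>N\<close> consists of the first \<open>n\<close> columns of the identity and the last \<open>k\<close> columns of \<open>xI + S\<close>.\<close>
  let ?lift = "map_mat (\<lambda>a. [:a:])"
  let ?z = "[:-m, 0, 1:]"
  define M where "M = char_poly_matrix S"
  define N where "N = four_block_mat (1\<^sub>m n) (?lift C) (0\<^sub>m k n) (char_poly_matrix (- D))"
  have Sc: "S \<in> carrier_mat (n + k) (n + k)" unfolding S using B D by simp
  have D': "char_poly_matrix (- D) \<in> carrier_mat k k" using D by simp
  have M: "M \<in> carrier_mat (n + k) (n + k)" unfolding M_def using Sc by simp
  have N: "N \<in> carrier_mat (n + k) (n + k)" unfolding N_def using D' by simp
  have M_block: "M = four_block_mat (char_poly_matrix B) (?lift (- C)) (?lift (- C')) (char_poly_matrix D)"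
    unfolding M_def S using B C C' D by (intro eq_matI) (auto simp: char_poly_matrix_def)
  have colN: "col N j = (if j < n then unit_vec (n + k) j else col (char_poly_matrix (- S)) j)"
    if j: "j < n + k" for j
    unfolding N_def S using B C C' D j
    by (intro eq_vecI) (auto simp: char_poly_matrix_def)
  \<comment> \<open>The unit columns of \<open>N\<close> copy the first \<open>n\<close> columns of
    \<open>M\<close>, and the others reproduce the last \<open>k\<close> columns of
    \<open>(xI - S)(xI + S) = (x^2 - m)I\<close>. The product is thus block lower triangular with
    determinant \<open>det (xI - B) * (x^2 - m)^k\<close>.\<close>
  have MN: "M * N = four_block_mat (char_poly_matrix B) (0\<^sub>m n k) (?lift (- C')) (?z \<cdot>\<^sub>m 1\<^sub>m k)"
    (is "_ = ?R")
  proof (rule eq_matI)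
    fix i j assume "i < dim_row ?R" "j < dim_col ?R"
    hence i: "i < n + k" and j: "j < n + k"
      using char_poly_matrix_closed[OF B] by auto
    have ij: "(M * N) $$ (i,j) = row M i \<bullet> col N j" using M N i j by simp
    show "(M * N) $$ (i,j) = ?R $$ (i,j)"
    proof (cases "j < n")
      case True
      hence "(M * N) $$ (i,j) = M $$ (i,j)"
        unfolding ij using colN[OF j] M i j by (simp add: scalar_prod_right_unit)
      also have "\<dots> = ?R $$ (i,j)"
        unfolding M_block using True i j C C' D carrier_matD[OF char_poly_matrix_closed[OF B]]
          carrier_matD[OF char_poly_matrix_closed[OF D]]
        by auto
      finally show ?thesis .
    next
      case False
      hence "(M * N) $$ (i,j) = row M i \<bullet> col (char_poly_matrix (- S)) j"
        unfolding ij using colN[OF j] by simp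
      also have "\<dots> = (char_poly_matrix S * char_poly_matrix (- S)) $$ (i,j)"
        unfolding M_def using i j Sc by (simp add: char_poly_matrix_def)
      also have "\<dots> = ?R $$ (i,j)"
        unfolding char_poly_matrix_times_uminus[OF Sc sq]
        using False i j carrier_matD[OF char_poly_matrix_closed[OF B]] by auto
      finally show ?thesis .
    qed
  qed (use M N carrier_matD[OF char_poly_matrix_closed[OF B]] in auto)
  have "det M * det N = det (M * N)" by (rule det_mult[symmetric, OF M N])
  also have "\<dots> = det (char_poly_matrix B) * det (?z \<cdot>\<^sub>m 1\<^sub>m k)"
    unfolding MN by (rule det_four_block_mat_upper_right_zero) (use B C' in auto)
  also have "det N = det (1\<^sub>m n) * det (char_poly_matrix (- D))"
    unfolding N_def by (rule det_four_block_mat_lower_left_zero) (use C D' in auto)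
  finally show ?thesis unfolding char_poly_def M_def by (simp add: det_smult)
qed

lemma det_dim_two:
  fixes A :: "'a :: comm_ring_1 mat"
  assumes A: "A \<in> carrier_mat 2 2"
  shows "det A = A $$ (0,0) * A $$ (1,1) - A $$ (0,1) * A $$ (1,0)"
proof -
  have del: "mat_delete A i 0 \<in> carrier_mat 1 1" for i
    using mat_delete_carrier[of A 2 2 i 0] A by simp
  have "det A = (\<Sum>i<2. A $$ (i,0) * cofactor A i 0)"
    by (rule laplace_expansion_column[OF A]) simp
  also have "\<dots> = A $$ (0,0) * cofactor A 0 0 + A $$ (1,0) * cofactor A 1 0"
    by (simp add: lessThan_nat_numeral)
  also have "cofactor A 0 0 = A $$ (1,1)"
    using A by (simp add: cofactor_def det_single[OF del]) (simp add: mat_delete_def)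
  also have "cofactor A 1 0 = - A $$ (0,1)"
    using A by (simp add: cofactor_def det_single[OF del]) (simp add: mat_delete_def)
  finally show ?thesis by (simp add: algebra_simps)
qed

lemma det_dim_three:
  fixes A :: "'a :: comm_ring_1 mat"
  assumes A: "A \<in> carrier_mat 3 3"
  shows "det A = A $$ (0,0) * (A $$ (1,1) * A $$ (2,2) - A $$ (1,2) * A $$ (2,1))
    - A $$ (1,0) * (A $$ (0,1) * A $$ (2,2) - A $$ (0,2) * A $$ (2,1))
    + A $$ (2,0) * (A $$ (0,1) * A $$ (1,2) - A $$ (0,2) * A $$ (1,1))"
proof -
  have del: "mat_delete A i 0 \<in> carrier_mat 2 2" for i
    using mat_delete_carrier[of A 3 3 i 0] A by simp
  have "det A = (\<Sum>i<3. A $$ (i,0) * cofactor A i 0)"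
    by (rule laplace_expansion_column[OF A]) simp
  also have "\<dots> = A $$ (0,0) * cofactor A 0 0 + A $$ (1,0) * cofactor A 1 0 + A $$ (2,0) * cofactor A 2 0"
    by (simp add: lessThan_nat_numeral)
  also have "cofactor A 0 0 = A $$ (1,1) * A $$ (2,2) - A $$ (1,2) * A $$ (2,1)"
    using A by (simp add: cofactor_def det_dim_two[OF del]) (simp add: mat_delete_def numeral_2_eq_2)
  also have "cofactor A 1 0 = - (A $$ (0,1) * A $$ (2,2) - A $$ (0,2) * A $$ (2,1))"
    using A by (simp add: cofactor_def det_dim_two[OF del]) (simp add: mat_delete_def numeral_2_eq_2)
  also have "cofactor A 2 0 = A $$ (0,1) * A $$ (1,2) - A $$ (0,2) * A $$ (1,1)"
    using A by (simp add: cofactor_def det_dim_two[OF del]) (simp add: mat_delete_def numeral_2_eq_2)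
  finally show ?thesis by (simp add: algebra_simps)
qed

section \<open>Integer Gram matrices of rank one, two and three\<close>

text \<open>Cauchy--Schwarz between two rows, by expanding \<open>\<Sum>\<^sub>k (P\<^sub>j\<^sub>k - s P\<^sub>i\<^sub>k)\<^sup>2 = 2 c (d - s P\<^sub>i\<^sub>j)\<close>.\<close>

lemma row_difference_square:
  fixes P :: "nat \<Rightarrow> nat \<Rightarrow> int"
  assumes sym: "\<And>i j. \<lbrakk>i < n; j < n\<rbrakk> \<Longrightarrow> P i j = P j i"
    and diag: "\<And>i. i < n \<Longrightarrow> P i i = d"
    and sq: "\<And>i j. \<lbrakk>i < n; j < n\<rbrakk> \<Longrightarrow> (\<Sum>k<n. P i k * P k j) = c * P i j"
    and s: "s * s = 1" and i: "i < n" and j: "j < n"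
  shows "(\<Sum>k<n. (P j k - s * P i k)\<^sup>2) = 2 * c * (d - s * P i j)"
proof -
  have "(\<Sum>k<n. (P j k - s * P i k)\<^sup>2)
    = (\<Sum>k<n. P j k * P k j + (s * s) * (P i k * P k i) - 2 * s * (P i k * P k j))"
    using i j by (intro sum.cong refl) (simp add: sym[of _ i] sym[of _ j] power2_eq_square algebra_simps)
  also have "\<dots> = c * d + c * d - 2 * s * (c * P i j)"
    using i j by (simp add: s sum.distrib sum_subtractf sq diag flip: sum_distrib_left)
  finally show ?thesis by (simp add: algebra_simps)
qed

text \<open>A symmetric \<open>P\<close> with \<open>P^2 = cP\<close> and \<open>c > 0\<close> is a
  Gram matrix up to scale, so this is Cauchy-Schwarz for vectors of equal length; the sum of squares
  is used with \<open>s = 1\<close> and \<open>s = -1\<close>.\<close>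

lemma scaled_projection_entry_bound:
  fixes P :: "nat \<Rightarrow> nat \<Rightarrow> int"
  assumes "\<And>i j. \<lbrakk>i < n; j < n\<rbrakk> \<Longrightarrow> P i j = P j i" "\<And>i. i < n \<Longrightarrow> P i i = d"
    and "\<And>i j. \<lbrakk>i < n; j < n\<rbrakk> \<Longrightarrow> (\<Sum>k<n. P i k * P k j) = c * P i j"
    and c: "c > 0" and i: "i < n" and j: "j < n"
  shows "\<bar>P i j\<bar> \<le> d"
proof -
  have "s * P i j \<le> d" if s: "s * s = 1" for s
  proof -
    have "0 \<le> (\<Sum>k<n. (P j k - s * P i k)\<^sup>2)" by (intro sum_nonneg) simp
    hence "0 \<le> 2 * c * (d - s * P i j)"
      by (subst (asm) row_difference_square[of n P d c s i j]) (use assms s in auto)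
    thus ?thesis using c by (simp add: zero_le_mult_iff)
  qed
  from this[of 1] this[of "-1"] show ?thesis by simp
qed

text \<open>The equality case of Cauchy-Schwarz: the sum of squares vanishes, hence every term
  does.\<close>

lemma scaled_projection_parallel_rows:
  fixes P :: "nat \<Rightarrow> nat \<Rightarrow> int"
  assumes "\<And>i j. \<lbrakk>i < n; j < n\<rbrakk> \<Longrightarrow> P i j = P j i" "\<And>i. i < n \<Longrightarrow> P i i = d"
    and "\<And>i j. \<lbrakk>i < n; j < n\<rbrakk> \<Longrightarrow> (\<Sum>k<n. P i k * P k j) = c * P i j"
    and i: "i < n" and j: "j < n" and k: "k < n" and s: "s * s = 1" and eq: "s * P i j = d"
  shows "P j k = s * P i k"
proof -
  have "(\<Sum>k<n. (P j k - s * P i k)\<^sup>2) = 0"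
    using row_difference_square[of n P d c s i j] assms by simp
  hence "(P j k - s * P i k)\<^sup>2 = 0" using k by (subst (asm) sum_nonneg_eq_0_iff) auto
  thus ?thesis by simp
qed

text \<open>An odd integer of absolute value at most 1 is a sign, so every pair of rows is an
  equality case and row 0 can serve as \<open>v\<close>.\<close>

lemma rank_one_sign_gram:
  fixes P :: "nat \<Rightarrow> nat \<Rightarrow> int"
  assumes sym: "\<And>i j. \<lbrakk>i < n; j < n\<rbrakk> \<Longrightarrow> P i j = P j i" and diag: "\<And>i. i < n \<Longrightarrow> P i i = 1"
    and sq: "\<And>i j. \<lbrakk>i < n; j < n\<rbrakk> \<Longrightarrow> (\<Sum>k<n. P i k * P k j) = c * P i j"
    and c: "c > 0" and odd: "\<And>i j. \<lbrakk>i < n; j < n\<rbrakk> \<Longrightarrow> odd (P i j)" and n: "n > 0"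
  obtains v where "\<And>i. i < n \<Longrightarrow> v i \<in> {1, -1}" "\<And>i j. \<lbrakk>i < n; j < n\<rbrakk> \<Longrightarrow> P i j = v i * v j"
proof
  have pm: "P i j \<in> {1, -1}" if "i < n" "j < n" for i j
  proof -
    have "\<bar>P i j\<bar> \<le> 1" by (rule scaled_projection_entry_bound[OF sym diag sq c that])
    moreover have "P i j \<noteq> 0" using odd[OF that] by auto
    ultimately show ?thesis by auto
  qed
  show "P 0 i \<in> {1, -1}" if "i < n" for i using pm n that by blast
  show "P i j = P 0 i * P 0 j" if ij: "i < n" "j < n" for i j
    by (rule scaled_projection_parallel_rows[OF sym diag sq]) (use pm[of 0 i] n ij in auto)
qed

text \<open>Entries lie in \<open>{0,1,-1}\<close>, and a nonzero entry makes two rows parallel. A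
  row has squared norm \<open>2t\<close>, so its support is half of the \<open>4t\<close> indices;
  two rows with entry 0 between them have disjoint supports, which fill everything. These two rows
  are \<open>u\<close> and \<open>w\<close>.\<close>

lemma rank_two_gram:
  fixes P :: "nat \<Rightarrow> nat \<Rightarrow> int" and t :: nat
  assumes sym: "\<And>i j. \<lbrakk>i < n; j < n\<rbrakk> \<Longrightarrow> P i j = P j i" and diag: "\<And>i. i < n \<Longrightarrow> P i i = 1"
    and sq: "\<And>i j. \<lbrakk>i < n; j < n\<rbrakk> \<Longrightarrow> (\<Sum>k<n. P i k * P k j) = 2 * int t * P i j"
    and n: "n = 4 * t" and t: "t > 0"
  obtains p q u w where "p < n" "q < n" "u p = 1" "u q = 0" "w p = 0" "w q = 1"
    "\<And>i. i < n \<Longrightarrow> u i \<in> {0,1,-1}" "\<And>i. i < n \<Longrightarrow> w i \<in> {0,1,-1}"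
    "\<And>i. i < n \<Longrightarrow> (u i = 0) = (w i \<noteq> 0)"
    "\<And>i j. \<lbrakk>i < n; j < n\<rbrakk> \<Longrightarrow> P i j = u i * u j + w i * w j"
    "(\<Sum>i<n. u i * u i) = 2 * int t" "(\<Sum>i<n. w i * w i) = 2 * int t"
proof -
  have bound: "P i j \<in> {0,1,-1}" if "i < n" "j < n" for i j
    using scaled_projection_entry_bound[OF sym diag sq _ that] t by fastforce
  have par: "P j k = P i j * P i k" if "i < n" "j < n" "k < n" "P i j \<noteq> 0" for i j k
    by (rule scaled_projection_parallel_rows[OF sym diag sq]) (use bound[OF that(1,2)] that in auto)
  have norm: "(\<Sum>k<n. P i k * P i k) = 2 * int t" if "i < n" for i
    using sq[OF that that] sym that diag by (simp add: sym[of i])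
  define supp where "supp i = {k. k < n \<and> P i k \<noteq> 0}" for i
  have fin: "finite (supp i)" for i unfolding supp_def by simp
  have card: "card (supp i) = 2 * t" if i: "i < n" for i
  proof -
    have "(\<Sum>k<n. P i k * P i k) = (\<Sum>k\<in>supp i. P i k * P i k)"
      by (rule sum.mono_neutral_right) (auto simp: supp_def)
    also have "\<dots> = (\<Sum>k\<in>supp i. 1)"
    proof (rule sum.cong)
      fix k assume "k \<in> supp i"
      thus "P i k * P i k = 1" using bound[OF i, of k] unfolding supp_def by auto
    qed simp
    finally show ?thesis using norm[OF i] by simp
  qed
  have n0: "0 < n" using n t by simp
  have "\<exists>q<n. P 0 q = 0"
  proof (rule ccontr)
    assume "\<not> ?thesis"
    hence "supp 0 = {..<n}" unfolding supp_def by auto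
    thus False using card[OF n0] n t by simp
  qed
  then obtain q where q: "q < n" "P 0 q = 0" by blast
  have disj: "supp 0 \<inter> supp q = {}"
  proof (rule ccontr)
    assume "\<not> ?thesis"
    then obtain k where k: "k < n" "P 0 k \<noteq> 0" "P q k \<noteq> 0" unfolding supp_def by auto
    have "P k q = P 0 k * P 0 q" using par[of 0 k q] n0 k q by simp
    thus False using q k sym by simp
  qed
  have "card (supp 0 \<union> supp q) = card {..<n}"
    using card[OF n0] card[OF q(1)] card_Un_disjoint[OF fin fin disj] n by simp
  hence un: "supp 0 \<union> supp q = {..<n}"
    by (intro card_subset_eq) (auto simp: supp_def)
  have cases: "(P 0 i = 0) = (P q i \<noteq> 0)" if "i < n" for i
    using disj un that unfolding supp_def by blast
  show thesis
  proof (rule that[of 0 q "P 0" "P q"])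
    fix i j assume ij: "i < n" "j < n"
    show "P i j = P 0 i * P 0 j + P q i * P q j"
      using par[of 0 i j] par[of q i j] cases[OF ij(1)] n0 q ij by (cases "P 0 i = 0") auto
  qed (use n0 q sym[of 0 q] diag bound cases norm in auto)
qed

text \<open>Rows are grouped into classes of parallel ones, \<open>\<bar>P i k\<bar> = 3\<close>. There are four classes of size \<open>t\<close>, and
  suitably signed representatives \<open>a\<close>, \<open>b\<close>, \<open>c\<close>, \<open>d\<close> have pairwise inner product \<open>-1\<close>, like the four
  diagonals \<open>(1,1,1)\<close>, \<open>(1,-1,-1)\<close>, \<open>(-1,1,-1)\<close>, \<open>(-1,-1,1)\<close> of a cube; half the sum of the first
  and another one is a coordinate vector.\<close>

lemma cube_diagonals_gram:
  fixes P :: "nat \<Rightarrow> nat \<Rightarrow> int" and t :: nat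
  assumes sym: "\<And>i j. \<lbrakk>i < n; j < n\<rbrakk> \<Longrightarrow> P i j = P j i" and diag: "\<And>i. i < n \<Longrightarrow> P i i = 3"
    and sq: "\<And>i j. \<lbrakk>i < n; j < n\<rbrakk> \<Longrightarrow> (\<Sum>k<n. P i k * P k j) = 4 * int t * P i j"
    and odd: "\<And>i j. \<lbrakk>i < n; j < n\<rbrakk> \<Longrightarrow> odd (P i j)"
    and n: "n = 4 * t" and t: "t > 0" and a: "a < n"
  obtains C :: "nat \<Rightarrow> nat \<Rightarrow> int" where "\<And>i x. \<lbrakk>i < n; x < 3\<rbrakk> \<Longrightarrow> C i x \<in> {1, -1}" "\<And>x. x < 3 \<Longrightarrow> C a x = 1"
    "\<And>i j. \<lbrakk>i < n; j < n\<rbrakk> \<Longrightarrow> P i j = (\<Sum>x<3. C i x * C j x)"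
    "\<And>x y. \<lbrakk>x < 3; y < 3\<rbrakk> \<Longrightarrow> (\<Sum>i<n. C i x * C i y) = (if x = y then 4 * int t else 0)"
proof -
  have bound: "\<bar>P i j\<bar> \<le> 3" if "i < n" "j < n" for i j
    by (rule scaled_projection_entry_bound[OF sym diag sq _ that]) (use t in auto)
  have vals: "P i j \<in> {1,-1,3,-3}" if "i < n" "j < n" for i j
  proof -
    have "P i j \<in> {-3..3}" using bound[OF that] by auto
    hence "P i j \<in> {-3,-2,-1,0,1,2,3}" by (auto simp: atLeastAtMost_iff)
    thus ?thesis using odd[OF that] by auto
  qed
  define cls where "cls i = {k. k < n \<and> \<bar>P i k\<bar> = 3}" for i
  have fin: "finite (cls i)" for i unfolding cls_def by simp
  have par: "\<exists>s\<in>{1,-1}. P i k = 3 * s \<and> (\<forall>j<n. P j k = s * P j i)"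
    if i: "i < n" and k: "k \<in> cls i" for i k
  proof -
    have kn: "k < n" "\<bar>P i k\<bar> = 3" using k unfolding cls_def by auto
    then obtain s where s: "s \<in> {1,-1}" "P i k = 3 * s"
      by (cases "P i k = 3") (auto simp: abs_if split: if_splits)
    have "P k j = s * P i j" if "j < n" for j
      by (rule scaled_projection_parallel_rows[OF sym diag sq]) (use s i kn that in auto)
    thus ?thesis using s sym i kn by metis
  qed
  have norm: "(\<Sum>k<n. P i k * P i k) = 12 * int t" if i: "i < n" for i
  proof -
    have "(\<Sum>k<n. P i k * P i k) = (\<Sum>k<n. P i k * P k i)"
      by (rule sum.cong) (use sym i in auto)
    thus ?thesis using sq[OF i i] diag[OF i] by simp
  qed
  \<comment> \<open>The squared norm \<open>12t\<close> of a row counts 1 for each of the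
    \<open>4t\<close> entries and a further 8 for each entry 3 or -3.\<close>
  have card: "card (cls i) = t" if i: "i < n" for i
  proof -
    have "(\<Sum>k<n. P i k * P i k) = (\<Sum>k<n. 1 + 8 * (if \<bar>P i k\<bar> = 3 then 1 else 0))"
    proof (rule sum.cong)
      fix k assume "k \<in> {..<n}"
      thus "P i k * P i k = 1 + 8 * (if \<bar>P i k\<bar> = 3 then 1 else 0)" using vals[OF i, of k] by auto
    qed simp
    also have "\<dots> = int n + 8 * int (card ({..<n} \<inter> {k. \<bar>P i k\<bar> = 3}))"
      by (simp add: sum.distrib sum.If_cases flip: sum_distrib_left)
    also have "{..<n} \<inter> {k. \<bar>P i k\<bar> = 3} = cls i" unfolding cls_def by auto
    finally show ?thesis using norm[OF i] n by simp
  qed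
  have disj: "cls i \<inter> cls j = {}" if ij: "i < n" "j < n" "j \<notin> cls i" for i j
  proof (rule ccontr)
    assume "\<not> ?thesis"
    then obtain k where k: "k \<in> cls i" "k \<in> cls j" by auto
    obtain s where "s \<in> {1,-1}" "P j k = s * P j i" using par[OF ij(1) k(1)] ij by blast
    moreover have "\<bar>P j k\<bar> = 3" using k(2) unfolding cls_def by simp
    ultimately have "\<bar>P j i\<bar> = 3" by auto
    thus False using ij sym unfolding cls_def by simp
  qed
  have pick: "\<exists>y<n. y \<notin> X" if "card X < n" "finite X" for X
    using that by (metis card_lessThan card_mono lessThan_iff not_le subsetI)
  have "card (cls a) < n" using card[OF a] n t by simp
  then obtain b where b: "b < n" "b \<notin> cls a" using pick[OF _ fin] by blast
  have cab: "card (cls a \<union> cls b) \<le> 2 * t"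
    using card_Un_le[of "cls a" "cls b"] card[OF a] card[OF b(1)] by simp
  hence "card (cls a \<union> cls b) < n" using n t by simp
  then obtain c where c: "c < n" "c \<notin> cls a" "c \<notin> cls b"
    using pick[of "cls a \<union> cls b"] fin by blast
  have "card (cls a \<union> cls b \<union> cls c) \<le> 3 * t"
    using card_Un_le[of "cls a \<union> cls b" "cls c"] cab card[OF c(1)] by simp
  hence "card (cls a \<union> cls b \<union> cls c) < n" using n t by simp
  then obtain d where d: "d < n" "d \<notin> cls a" "d \<notin> cls b" "d \<notin> cls c"
    using pick[of "cls a \<union> cls b \<union> cls c"] fin by blast
  have dj: "cls a \<inter> cls b = {}" "(cls a \<union> cls b) \<inter> cls c = {}" "(cls a \<union> cls b \<union> cls c) \<inter> cls d = {}"
    using disj[OF a b(1) b(2)] disj[OF a c(1) c(2)] disj[OF b(1) c(1) c(3)]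
      disj[OF a d(1) d(2)] disj[OF b(1) d(1) d(3)] disj[OF c(1) d(1) d(4)] by auto
  have "card (cls a \<union> cls b \<union> cls c \<union> cls d) = n"
    using dj fin card[OF a] card[OF b(1)] card[OF c(1)] card[OF d(1)] n
    by (simp add: card_Un_disjoint)
  hence cover: "cls a \<union> cls b \<union> cls c \<union> cls d = {..<n}"
    by (intro card_subset_eq) (auto simp: cls_def)
  \<comment> \<open>Each of the four classes contributes \<open>t\<close> equal terms to the
    \<open>(i,j)\<close> entry of \<open>P^2 = 4t P\<close>; the factor \<open>t\<close> is
    cancelled.\<close>
  have compress: "4 * P i j = P i a * P j a + P i b * P j b + P i c * P j c + P i d * P j d"
    if ij: "i < n" "j < n" for i j
  proof -
    have on_cls: "(\<Sum>k\<in>cls z. P i k * P j k) = int t * (P i z * P j z)" if z: "z < n" for z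
    proof -
      have "(\<Sum>k\<in>cls z. P i k * P j k) = (\<Sum>k\<in>cls z. P i z * P j z)"
      proof (rule sum.cong)
        fix k assume "k \<in> cls z"
        then obtain s where "s \<in> {1,-1}" "\<forall>j<n. P j k = s * P j z" using par[OF z] by blast
        thus "P i k * P j k = P i z * P j z" using ij by auto
      qed simp
      thus ?thesis using card[OF z] by simp
    qed
    have "4 * int t * P i j = (\<Sum>k<n. P i k * P j k)"
      using sq[OF ij] sym ij by (simp add: sym[of j])
    also have "\<dots> = int t * (P i a * P j a) + int t * (P i b * P j b)
        + int t * (P i c * P j c) + int t * (P i d * P j d)"
      unfolding cover[symmetric] using dj fin
      by (simp add: sum.union_disjoint on_cls a b c d)
    finally have "int t * (4 * P i j) = int t * (P i a * P j a + P i b * P j b + P i c * P j c + P i d * P j d)"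
      by (simp add: algebra_simps)
    thus ?thesis using t by simp
  qed
  have pm: "P i j \<in> {1,-1}" if "i < n" "j < n" "j \<notin> cls i" for i j
    using vals[OF that(1,2)] that unfolding cls_def by auto
  note pms = pm[OF a b(1,2)] pm[OF a c(1,2)] pm[OF a d(1,2)] pm[OF b(1) c(1,3)]
    pm[OF b(1) d(1,3)] pm[OF c(1) d(1,4)]
  note syms = sym[OF b(1) a] sym[OF c(1) a] sym[OF d(1) a] sym[OF c(1) b(1)] sym[OF d(1) b(1)] sym[OF d(1) c(1)]
  note diags = diag[OF a] diag[OF b(1)] diag[OF c(1)] diag[OF d(1)]
  \<comment> \<open>\<open>compress\<close> at \<open>(a,b)\<close> and \<open>(a,c)\<close>. A sum
    of two signs equal to 2 or -2 forces both summands to be equal, which gives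
    \<open>tri\<close>.\<close>
  have "P a c * P b c + P a d * P b d = - 2 * P a b" "P a b * P b c + P a d * P c d = - 2 * P a c"
    using compress[OF a b(1)] compress[OF a c(1)] unfolding syms diags by simp_all
  hence tri: "P b c = - P a b * P a c" "P b d = - P a b * P a d" "P c d = - P a c * P a d"
    using pms by auto
  define Rb Rc Rd where "Rb k = - P a b * P b k" and "Rc k = - P a c * P c k"
    and "Rd k = - P a d * P d k" for k
  \<comment> \<open>Column \<open>k\<close> is, up to sign, the column of the representative of its
    class. After the rescaling in \<open>Rb\<close>, \<open>Rc\<close>, \<open>Rd\<close> such a
    column lists the inner products of one cube diagonal with all four: 3 with itself, -1 with the
    others.\<close>
  have quad: "(P a k, Rb k, Rc k, Rd k) \<in> {(3,-1,-1,-1),(-1,3,-1,-1),(-1,-1,3,-1),(-1,-1,-1,3),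
      (-3,1,1,1),(1,-3,1,1),(1,1,-3,1),(1,1,1,-3)}" if k: "k < n" for k
  proof -
    have "\<exists>z\<in>{a,b,c,d}. k \<in> cls z" using cover k by auto
    then obtain z where z: "z \<in> {a,b,c,d}" "k \<in> cls z" by blast
    then obtain s where s: "s \<in> {1,-1}" "\<And>j. j < n \<Longrightarrow> P j k = s * P j z"
      using par[of z k] a b c d by blast
    have val: "(P a k, Rb k, Rc k, Rd k)
      = (s * P a z, - P a b * (s * P b z), - P a c * (s * P c z), - P a d * (s * P d z))"
      unfolding Rb_def Rc_def Rd_def using s(2)[OF a] s(2)[OF b(1)] s(2)[OF c(1)] s(2)[OF d(1)] by simp
    consider "z = a" | "z = b" | "z = c" | "z = d" using z(1) by blast
    thus ?thesis
    proof cases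
      case 1
      show ?thesis using s(1) pms(1-3) unfolding val 1 syms diags by (elim insertE emptyE; simp)
    next
      case 2
      show ?thesis using s(1) pms(1-3) unfolding val 2 syms diags tri by (elim insertE emptyE; simp)
    next
      case 3
      show ?thesis using s(1) pms(1-3) unfolding val 3 syms diags tri by (elim insertE emptyE; simp)
    next
      case 4
      show ?thesis using s(1) pms(1-3) unfolding val 4 syms diags tri by (elim insertE emptyE; simp)
    qed
  qed
  \<comment> \<open>In every case of \<open>quad\<close> these sums are 2 or -2, so the division is
    exact and yields a sign.\<close>
  define c0 c1 c2 where "c0 k = (P a k + Rb k) div 2" and "c1 k = (P a k + Rc k) div 2"
    and "c2 k = (P a k + Rd k) div 2" for k
  have c_pm: "c0 k \<in> {1,-1}" "c1 k \<in> {1,-1}" "c2 k \<in> {1,-1}"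
    and R_c: "P a k = c0 k + c1 k + c2 k" "Rb k = c0 k - c1 k - c2 k"
      "Rc k = c1 k - c0 k - c2 k" "Rd k = c2 k - c0 k - c1 k" if k: "k < n" for k
    using quad[OF k] unfolding c0_def c1_def c2_def by (elim insertE emptyE; simp)+
  have P_c: "P i j = c0 i * c0 j + c1 i * c1 j + c2 i * c2 j" if ij: "i < n" "j < n" for i j
  proof -
    have "P i z * P j z = (- s * P z i) * (- s * P z j)" if "s \<in> {1,-1}" "z < n" for s z
      using that(1) sym[OF that(2) ij(1)] sym[OF that(2) ij(2)] by auto
    hence "P i b * P j b = Rb i * Rb j" "P i c * P j c = Rc i * Rc j" "P i d * P j d = Rd i * Rd j"
      unfolding Rb_def Rc_def Rd_def using pms(1-3) b c d by blast+
    hence "4 * P i j = P a i * P a j + Rb i * Rb j + Rc i * Rc j + Rd i * Rd j"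
      using compress[OF ij] sym[OF a ij(1)] sym[OF a ij(2)] by simp
    \<comment> \<open>The outer products of the four cube diagonals add up to four times the 3 by 3
      identity, so the cross terms cancel.\<close>
    thus ?thesis unfolding R_c[OF ij(1)] R_c[OF ij(2)] by (simp add: algebra_simps)
  qed
  have c_at: "c0 a = 1" "c1 a = 1" "c2 a = 1"
    using pms(1-3) unfolding c0_def c1_def c2_def Rb_def Rc_def Rd_def syms diags
    by (elim insertE emptyE; simp)+
  have gram: "(\<Sum>k<n. P x k * P y k) = 4 * int t * P x y" if "x < n" "y < n" for x y
    using sq[OF that] by (simp add: sym[of y] that)
  have gram_scaled: "(\<Sum>k<n. (u * P x k) * (v * P y k)) = 4 * int t * (u * v * P x y)"
    if "x < n" "y < n" for x y u v
  proof -
    have "(\<Sum>k<n. (u * P x k) * (v * P y k)) = u * v * (\<Sum>k<n. P x k * P y k)"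
      unfolding sum_distrib_left by (rule sum.cong) auto
    thus ?thesis using gram[OF that] by simp
  qed
  have gram_R: "(\<Sum>k<n. P a k * P a k) = 12 * int t" "(\<Sum>k<n. P a k * Rb k) = -4 * int t"
    "(\<Sum>k<n. P a k * Rc k) = -4 * int t" "(\<Sum>k<n. P a k * Rd k) = -4 * int t"
    "(\<Sum>k<n. Rb k * Rb k) = 12 * int t" "(\<Sum>k<n. Rc k * Rc k) = 12 * int t"
    "(\<Sum>k<n. Rd k * Rd k) = 12 * int t" "(\<Sum>k<n. Rb k * Rc k) = -4 * int t"
    "(\<Sum>k<n. Rb k * Rd k) = -4 * int t" "(\<Sum>k<n. Rc k * Rd k) = -4 * int t"
    using gram_scaled[OF a a, of 1 1] gram_scaled[OF a b(1), of 1 "- P a b"]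
      gram_scaled[OF a c(1), of 1 "- P a c"] gram_scaled[OF a d(1), of 1 "- P a d"]
      gram_scaled[OF b(1) b(1), of "- P a b" "- P a b"] gram_scaled[OF c(1) c(1), of "- P a c" "- P a c"]
      gram_scaled[OF d(1) d(1), of "- P a d" "- P a d"] gram_scaled[OF b(1) c(1), of "- P a b" "- P a c"]
      gram_scaled[OF b(1) d(1), of "- P a b" "- P a d"] gram_scaled[OF c(1) d(1), of "- P a c" "- P a d"] pms(1-3)
    unfolding Rb_def Rc_def Rd_def diags tri by auto
  have double: "2 * c0 k = P a k + Rb k" "2 * c1 k = P a k + Rc k" "2 * c2 k = P a k + Rd k"
    if k: "k < n" for k unfolding R_c[OF k] by auto
  have four: "4 * (\<Sum>k<n. f k * g k) = (\<Sum>k<n. P a k * P a k) + (\<Sum>k<n. P a k * G k)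
      + (\<Sum>k<n. P a k * F k) + (\<Sum>k<n. F k * G k)"
    if "\<And>k. k < n \<Longrightarrow> 2 * f k = P a k + F k" "\<And>k. k < n \<Longrightarrow> 2 * g k = P a k + G k" for f g F G
  proof -
    have "4 * (\<Sum>k<n. f k * g k) = (\<Sum>k<n. (2 * f k) * (2 * g k))"
      unfolding sum_distrib_left by (rule sum.cong) auto
    also have "\<dots> = (\<Sum>k<n. P a k * P a k + P a k * G k + P a k * F k + F k * G k)"
      using that by (intro sum.cong) (auto simp: algebra_simps)
    finally show ?thesis by (simp add: sum.distrib)
  qed
  \<comment> \<open>By \<open>four\<close> and \<open>gram_R\<close>, equal columns give
    \<open>12 - 4 - 4 + 12 = 16\<close> and different ones \<open>12 - 4 - 4 - 4 = 0\<close>, in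
    units of \<open>t\<close>, for four times the inner product.\<close>
  have gram_c: "(\<Sum>k<n. c0 k * c0 k) = 4 * int t" "(\<Sum>k<n. c1 k * c1 k) = 4 * int t"
    "(\<Sum>k<n. c2 k * c2 k) = 4 * int t" "(\<Sum>k<n. c0 k * c1 k) = 0" "(\<Sum>k<n. c0 k * c2 k) = 0"
    "(\<Sum>k<n. c1 k * c2 k) = 0"
    using four[OF double(1) double(1)] four[OF double(2) double(2)] four[OF double(3) double(3)]
      four[OF double(1) double(2)] four[OF double(1) double(3)] four[OF double(2) double(3)]
    unfolding gram_R by auto
  show thesis
  proof (rule that[of "\<lambda>i x. if x = 0 then c0 i else if x = 1 then c1 i else c2 i"])
    fix x y :: nat assume "x < 3" "y < 3"
    hence "x \<in> {0,1,2}" "y \<in> {0,1,2}" by auto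
    thus "(\<Sum>i<n. (if x = 0 then c0 i else if x = 1 then c1 i else c2 i)
        * (if y = 0 then c0 i else if y = 1 then c1 i else c2 i)) = (if x = y then 4 * int t else 0)"
      using gram_c by (auto simp: mult.commute[of "c1 _" "c0 _"] mult.commute[of "c2 _" "c0 _"]
        mult.commute[of "c2 _" "c1 _"])
  qed (use c_pm c_at P_c in \<open>auto simp: lessThan_nat_numeral\<close>)
qed

section \<open>Seidel matrices\<close>

definition seidel_fun :: "nat \<Rightarrow> (nat \<Rightarrow> nat \<Rightarrow> int) \<Rightarrow> bool" where
  "seidel_fun n B \<longleftrightarrow> (\<forall>i<n. B i i = 0) \<and> (\<forall>i<n. \<forall>j<n. B i j = B j i)
    \<and> (\<forall>i<n. \<forall>j<n. i \<noteq> j \<longrightarrow> B i j \<in> {1, -1})"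

text \<open>The matrix \<open>P = mI - B^2\<close>, measuring how far \<open>B\<close> is from
  squaring to \<open>mI\<close>.\<close>

definition defect :: "int \<Rightarrow> nat \<Rightarrow> (nat \<Rightarrow> nat \<Rightarrow> int) \<Rightarrow> nat \<Rightarrow> nat \<Rightarrow> int" where
  "defect m n B i j = (if i = j then m else 0) - (\<Sum>k<n. B i k * B k j)"

lemma seidel_funD:
  assumes "seidel_fun n B"
  shows "i < n \<Longrightarrow> B i i = 0" "\<lbrakk>i < n; j < n\<rbrakk> \<Longrightarrow> B i j = B j i"
    "\<lbrakk>i < n; j < n; i \<noteq> j\<rbrakk> \<Longrightarrow> B i j \<in> {1, -1}"
  using assms unfolding seidel_fun_def by blast+

lemma symmetric_seidel_mat_iff:
  assumes S: "S \<in> carrier_mat n n"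
  shows "symmetric_seidel_mat S \<longleftrightarrow> seidel_fun n (\<lambda>i j. S $$ (i,j))"
proof
  assume sym: "symmetric_seidel_mat S"
  hence "transpose_mat S $$ (i,j) = S $$ (i,j)" for i j unfolding symmetric_seidel_mat_def by simp
  hence "S $$ (i,j) = S $$ (j,i)" if "i < n" "j < n" for i j
    using S that by (metis carrier_matD index_transpose_mat(1))
  moreover have "S $$ (i,i) = 0" if "i < n" for i
    using sym S that unfolding symmetric_seidel_mat_def seidel_mat_def by simp
  moreover have "S $$ (i,j) \<in> {1,-1}" if "i < n" "j < n" "i \<noteq> j" for i j
  proof -
    have "S $$ (i,j) \<in> {0,1,-1}" "S $$ (i,j) \<noteq> 0"
      using sym carrier_matD(1)[OF S] that unfolding symmetric_seidel_mat_def seidel_mat_def by blast+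
    thus ?thesis by blast
  qed
  ultimately show "seidel_fun n (\<lambda>i j. S $$ (i,j))" unfolding seidel_fun_def by blast
next
  assume s: "seidel_fun n (\<lambda>i j. S $$ (i,j))"
  have "transpose_mat S = S"
    by (rule eq_matI) (use S s in \<open>auto simp: seidel_fun_def\<close>)
  moreover have "S $$ (i,j) \<in> {0, 1, -1}" if "i < n" "j < n" for i j
    using s that unfolding seidel_fun_def by (cases "i = j") auto
  moreover have "S $$ (i,j) \<noteq> 0" if "i < n" "j < n" "i \<noteq> j" for i j
  proof -
    have "S $$ (i,j) \<in> {1, -1}" using s that unfolding seidel_fun_def by blast
    thus ?thesis by auto
  qed
  ultimately show "symmetric_seidel_mat S"
    using S s unfolding symmetric_seidel_mat_def seidel_mat_def seidel_fun_def by auto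
qed

text \<open>Each row of \<open>B\<close> has \<open>n - 1\<close> entries of square 1. With
  \<open>m = 4t + 1\<close> and \<open>n = 4t + 2 - k\<close> the value is \<open>k\<close>.\<close>

lemma defect_diag:
  assumes B: "seidel_fun n B" and i: "i < n"
  shows "defect m n B i i = m - (int n - 1)"
proof -
  have "(\<Sum>k<n. B i k * B k i) = (\<Sum>k<n. 1 - (if k = i then 1 else 0))"
  proof (rule sum.cong)
    fix k assume "k \<in> {..<n}"
    thus "B i k * B k i = 1 - (if k = i then 1 else 0)"
      using seidel_funD(1)[OF B, of i] seidel_funD(3)[OF B, of i k] seidel_funD(2)[OF B, of k i] i by (cases "k = i") auto
  qed simp
  thus ?thesis using i unfolding defect_def by (simp add: sum_subtractf)
qed

text \<open>An off-diagonal entry of \<open>B^2\<close> is a sum of \<open>n - 2\<close> odd terms,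
  those for \<open>k = i\<close> and \<open>k = j\<close> being zero. The proof adds corrections
  that make each summand even.\<close>

lemma even_defect_iff:
  assumes B: "seidel_fun n B" and ij: "i < n" "j < n" "i \<noteq> j"
  shows "even (defect m n B i j) \<longleftrightarrow> even n"
proof -
  have "even (\<Sum>k<n. B i k * B k j + 1 + (if k = i then 1 else 0) + (if k = j then 1 else 0))"
  proof (rule dvd_sum)
    fix k assume k: "k \<in> {..<n}"
    have "B i k \<in> {1,-1}" if "k \<noteq> i" using seidel_funD(3)[OF B, of i k] ij k that by simp
    moreover have "B k j \<in> {1,-1}" if "k \<noteq> j" using seidel_funD(3)[OF B, of k j] ij k that by simp
    ultimately show "even (B i k * B k j + 1 + (if k = i then 1 else 0) + (if k = j then 1 else 0))"
      using seidel_funD(1)[OF B] ij by auto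
  qed
  thus ?thesis using ij unfolding defect_def by (simp add: sum.distrib)
qed

section \<open>Bordering a Seidel matrix and deleting a corner\<close>

lemma symmetric_seidel_four_block:
  assumes S: "S = four_block_mat B C (transpose_mat C) D"
    and B: "B \<in> carrier_mat n n" and C: "C \<in> carrier_mat n k" and D: "D \<in> carrier_mat k k"
    and "seidel_fun n (\<lambda>i j. B $$ (i,j))" "seidel_fun k (\<lambda>i j. D $$ (i,j))"
    and "\<And>i x. \<lbrakk>i < n; x < k\<rbrakk> \<Longrightarrow> C $$ (i,x) \<in> {1,-1}"
  shows "seidel_fun (n + k) (\<lambda>i j. S $$ (i,j))"
proof -
  have S_ij: "S $$ (i,j) = (if i < n then if j < n then B $$ (i,j) else C $$ (i, j - n)
      else if j < n then C $$ (j, i - n) else D $$ (i - n, j - n))" if "i < n + k" "j < n + k" for i j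
    unfolding S using that B C D by auto
  show ?thesis unfolding seidel_fun_def
  proof (intro conjI allI impI)
    fix i assume "i < n + k"
    thus "S $$ (i,i) = 0" using assms(5,6) unfolding seidel_fun_def by (simp add: S_ij)
  next
    fix i j assume ij: "i < n + k" "j < n + k"
    show "S $$ (i,j) = S $$ (j,i)" using assms(5,6) ij unfolding seidel_fun_def by (simp add: S_ij)
    assume "i \<noteq> j"
    thus "S $$ (i,j) \<in> {1,-1}"
      using assms(5,6) assms(7)[of i "j - n"] assms(7)[of j "i - n"] ij
      unfolding seidel_fun_def S_ij[OF ij] by (auto split: if_splits)
  qed
qed

text \<open>\<open>gram\<close>, \<open>BC\<close> and \<open>CC\<close> are the upper left, upper
  right and lower right blocks of \<open>S^2 = mI\<close> for the bordered matrix \<open>S\<close>;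
  the lower left block is the transpose of \<open>BC\<close> by symmetry of \<open>B\<close> and
  \<open>D\<close>.\<close>

lemma seidel_extension:
  fixes C D :: "nat \<Rightarrow> nat \<Rightarrow> int"
  assumes B: "B \<in> carrier_mat n n" "seidel_fun n (\<lambda>i j. B $$ (i,j))" and D: "seidel_fun k D"
    and C: "\<And>i x. \<lbrakk>i < n; x < k\<rbrakk> \<Longrightarrow> C i x \<in> {1,-1}"
    and gram: "\<And>i j. \<lbrakk>i < n; j < n\<rbrakk> \<Longrightarrow> defect m n (\<lambda>i j. B $$ (i,j)) i j = (\<Sum>x<k. C i x * C j x)"
    and BC: "\<And>i x. \<lbrakk>i < n; x < k\<rbrakk> \<Longrightarrow> (\<Sum>l<n. B $$ (i,l) * C l x) = - (\<Sum>y<k. C i y * D y x)"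
    and CC: "\<And>x y. \<lbrakk>x < k; y < k\<rbrakk> \<Longrightarrow>
      (\<Sum>i<n. C i x * C i y) + (\<Sum>z<k. D x z * D z y) = (if x = y then m else 0)"
  shows "\<exists>S. symmetric_seidel_mat S
    \<and> char_poly S * char_poly (mat k k (\<lambda>(x,y). - D x y)) = char_poly B * [:-m, 0, 1:] ^ k"
proof -
  let ?C = "mat n k (\<lambda>(i,x). C i x)" and ?D = "mat k k (\<lambda>(x,y). D x y)"
  let ?Ct = "transpose_mat ?C"
  define S where "S = four_block_mat B ?C ?Ct ?D"
  have Cc: "?C \<in> carrier_mat n k" and Ctc: "?Ct \<in> carrier_mat k n" and Dc: "?D \<in> carrier_mat k k"
    by auto
  have Sc: "S \<in> carrier_mat (n + k) (n + k)" unfolding S_def using B by simp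
  have symB: "B $$ (i,j) = B $$ (j,i)" if "i < n" "j < n" for i j
    using B(2) that unfolding seidel_fun_def by blast
  have symD: "D x y = D y x" if "x < k" "y < k" for x y
    using D that unfolding seidel_fun_def by blast
  have "seidel_fun (n + k) (\<lambda>i j. S $$ (i,j))"
    by (rule symmetric_seidel_four_block[OF S_def B(1) Cc Dc B(2)])
      (use D C in \<open>auto simp: seidel_fun_def\<close>)
  hence seidel: "symmetric_seidel_mat S" using symmetric_seidel_mat_iff[OF Sc] by simp
  have 1: "B * B + ?C * ?Ct = m \<cdot>\<^sub>m 1\<^sub>m n"
  proof (rule eq_matI)
    fix i j assume "i < dim_row (m \<cdot>\<^sub>m 1\<^sub>m n)" "j < dim_col (m \<cdot>\<^sub>m 1\<^sub>m n)"
    hence ij: "i < n" "j < n" by auto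
    have "(B * B + ?C * ?Ct) $$ (i,j) = (\<Sum>k<n. B $$ (i,k) * B $$ (k,j)) + (\<Sum>x<k. C i x * C j x)"
      using ij B(1) by (simp add: scalar_prod_def lessThan_atLeast0)
    also have "\<dots> = (if i = j then m else 0)" using gram[OF ij] unfolding defect_def by simp
    finally show "(B * B + ?C * ?Ct) $$ (i,j) = (m \<cdot>\<^sub>m 1\<^sub>m n) $$ (i,j)" using ij by simp
  qed (use B(1) in auto)
  have 2: "B * ?C + ?C * ?D = 0\<^sub>m n k"
  proof (rule eq_matI)
    fix i x assume "i < dim_row (0\<^sub>m n k :: int mat)" "x < dim_col (0\<^sub>m n k :: int mat)"
    hence ix: "i < n" "x < k" by auto
    have "(B * ?C + ?C * ?D) $$ (i,x) = (\<Sum>l<n. B $$ (i,l) * C l x) + (\<Sum>y<k. C i y * D y x)"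
      using ix B(1) by (simp add: scalar_prod_def lessThan_atLeast0)
    also have "\<dots> = 0" using BC[OF ix] by simp
    finally show "(B * ?C + ?C * ?D) $$ (i,x) = 0\<^sub>m n k $$ (i,x)" using ix by simp
  qed (use B(1) in auto)
  have 3: "?Ct * B + ?D * ?Ct = 0\<^sub>m k n"
  proof (rule eq_matI)
    fix x i assume "x < dim_row (0\<^sub>m k n :: int mat)" "i < dim_col (0\<^sub>m k n :: int mat)"
    hence ix: "i < n" "x < k" by auto
    have "(?Ct * B + ?D * ?Ct) $$ (x,i) = (\<Sum>l<n. C l x * B $$ (l,i)) + (\<Sum>y<k. D x y * C i y)"
      using ix B(1) by (simp add: scalar_prod_def lessThan_atLeast0)
    also have "\<dots> = (\<Sum>l<n. B $$ (i,l) * C l x) + (\<Sum>y<k. C i y * D y x)"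
      by (intro arg_cong2[of _ _ _ _ "(+)"] sum.cong) (auto simp: symB[OF _ ix(1)] symD[OF ix(2)])
    also have "\<dots> = 0" using BC[OF ix] by simp
    finally show "(?Ct * B + ?D * ?Ct) $$ (x,i) = 0\<^sub>m k n $$ (x,i)" using ix by simp
  qed (use B(1) in auto)
  have 4: "?Ct * ?C + ?D * ?D = m \<cdot>\<^sub>m 1\<^sub>m k"
  proof (rule eq_matI)
    fix x y assume "x < dim_row (m \<cdot>\<^sub>m 1\<^sub>m k)" "y < dim_col (m \<cdot>\<^sub>m 1\<^sub>m k)"
    hence xy: "x < k" "y < k" by auto
    have "(?Ct * ?C + ?D * ?D) $$ (x,y) = (\<Sum>i<n. C i x * C i y) + (\<Sum>z<k. D x z * D z y)"
      using xy by (simp add: scalar_prod_def lessThan_atLeast0)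
    also have "\<dots> = (if x = y then m else 0)" by (rule CC[OF xy])
    finally show "(?Ct * ?C + ?D * ?D) $$ (x,y) = (m \<cdot>\<^sub>m 1\<^sub>m k) $$ (x,y)" using xy by simp
  qed auto
  have "S * S = m \<cdot>\<^sub>m 1\<^sub>m (n + k)"
    unfolding S_def mult_four_block_mat[OF B(1) Cc Ctc Dc B(1) Cc Ctc Dc] 1 2 3 4
    by (rule eq_matI) auto
  from char_poly_complementary_block[OF B(1) Cc Ctc Dc S_def this]
  have "char_poly S * char_poly (- ?D) = char_poly B * [:-m, 0, 1:] ^ k" .
  moreover have "- ?D = mat k k (\<lambda>(x,y). - D x y)" by (rule eq_matI) auto
  ultimately show ?thesis using seidel by auto
qed

lemma seidel_restriction:
  assumes S: "S \<in> carrier_mat (n + k) (n + k)" "symmetric_seidel_mat S"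
    and sq: "S * S = m \<cdot>\<^sub>m 1\<^sub>m (n + k)"
  shows "\<exists>B. symmetric_seidel_mat B
    \<and> char_poly S * char_poly (mat k k (\<lambda>(x,y). - S $$ (n + x, n + y))) = char_poly B * [:-m, 0, 1:] ^ k"
proof -
  let ?B = "mat n n (\<lambda>(i,j). S $$ (i,j))" and ?C = "mat n k (\<lambda>(i,j). S $$ (i, n + j))"
  let ?C' = "mat k n (\<lambda>(i,j). S $$ (n + i, j))" and ?D = "mat k k (\<lambda>(i,j). S $$ (n + i, n + j))"
  have block: "S = four_block_mat ?B ?C ?C' ?D"
    using S(1) by (intro eq_matI) auto
  have "char_poly S * char_poly (- ?D) = char_poly ?B * [:-m, 0, 1:] ^ k"
    by (rule char_poly_complementary_block[OF _ _ _ _ block sq]) auto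
  moreover have "- ?D = mat k k (\<lambda>(x,y). - S $$ (n + x, n + y))" by (rule eq_matI) auto
  moreover have "symmetric_seidel_mat ?B"
  proof -
    have "seidel_fun (n + k) (\<lambda>i j. S $$ (i,j))" using symmetric_seidel_mat_iff[OF S(1)] S(2) by simp
    hence "seidel_fun n (\<lambda>i j. ?B $$ (i,j))" unfolding seidel_fun_def by simp
    thus ?thesis using symmetric_seidel_mat_iff[of ?B n] by simp
  qed
  ultimately show ?thesis by auto
qed

section \<open>Characteristic polynomials of negated corners of order one, two and three\<close>

lemma char_poly_seidel_one:
  assumes D: "seidel_fun 1 D"
  shows "char_poly (mat 1 1 (\<lambda>(x,y). - D x y)) = [:0, 1:]"
proof -
  have "D 0 0 = 0" using seidel_funD(1)[OF D, of 0] by simp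
  thus ?thesis unfolding char_poly_def
    by (subst det_single) (auto simp: char_poly_matrix_def)
qed

lemma char_poly_seidel_two:
  assumes D: "seidel_fun 2 D"
  shows "char_poly (mat 2 2 (\<lambda>(x,y). - D x y)) = [:-1, 0, 1:]"
proof -
  have "D 0 0 = 0" "D 1 1 = 0" "D 1 0 = D 0 1" "D 0 1 = 1 \<or> D 0 1 = -1"
    using seidel_funD(1)[OF D, of 0] seidel_funD(1)[OF D, of 1] seidel_funD(2)[OF D, of 1 0]
      seidel_funD(3)[OF D, of 0 1] by simp_all
  thus ?thesis unfolding char_poly_def
    by (subst det_dim_two) (auto simp: char_poly_matrix_def)
qed

text \<open>The only order of the three at which signs matter: product -1 gives
  \<open>(x - 2)(x + 1)^2\<close>, product 1 gives \<open>(x + 2)(x - 1)^2\<close>.\<close>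

lemma char_poly_seidel_three:
  assumes D: "seidel_fun 3 D"
  shows "char_poly (mat 3 3 (\<lambda>(x,y). - D x y)) = [:2 * (D 0 1 * D 0 2 * D 1 2), -3, 0, 1:]"
proof -
  have "D 0 0 = 0" "D 1 1 = 0" "D 2 2 = 0" "D 1 0 = D 0 1" "D 2 0 = D 0 2" "D 2 1 = D 1 2"
    "D 0 1 = 1 \<or> D 0 1 = -1" "D 0 2 = 1 \<or> D 0 2 = -1" "D 1 2 = 1 \<or> D 1 2 = -1"
    using seidel_funD(1)[OF D, of 0] seidel_funD(1)[OF D, of 1] seidel_funD(1)[OF D, of 2]
      seidel_funD(2)[OF D, of 1 0] seidel_funD(2)[OF D, of 2 0] seidel_funD(2)[OF D, of 2 1]
      seidel_funD(3)[OF D, of 0 1] seidel_funD(3)[OF D, of 0 2] seidel_funD(3)[OF D, of 1 2] by simp_all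
  thus ?thesis unfolding char_poly_def
    by (subst det_dim_three) (auto simp: char_poly_matrix_def)
qed

section \<open>Constructing the missing rows and columns from the spectrum\<close>

context spectral_decomposition
begin

lemma represents_defect: "represents (defect m n B) (\<lambda>x. real_of_int m - x * x)"
proof -
  have "represents (\<lambda>i j. (if i = j then m else 0) + (-1) * (\<Sum>k<n. B i k * B k j))
      (\<lambda>x. real_of_int m + real_of_int (-1) * (x * x))"
    by (intro represents_add represents_scalar represents_scale represents_mult represents_self)
  thus ?thesis unfolding defect_def[abs_def] by simp
qed

text \<open>On the spectrum \<open>m - x^2\<close> takes only the values \<open>m\<close> and 0, so
  \<open>P^2 = mP\<close>, and \<open>x (m - x^2)\<close> vanishes, so \<open>BP = 0\<close>. Since
  \<open>n\<close> is odd, all entries of \<open>P\<close> are odd. The new column \<open>v\<close>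
  lies in the kernel of \<open>B\<close>, which fits a zero corner.\<close>

lemma add_one_vertex:
  assumes B: "seidel_fun n B" and n: "n = 4 * t + 1"
    and spec: "\<And>k. k < n \<Longrightarrow> e k = 0 \<or> e k * e k = real (4 * t + 1)"
  obtains v where "\<And>i. i < n \<Longrightarrow> v i \<in> {1, -1}"
    "\<And>i j. \<lbrakk>i < n; j < n\<rbrakk> \<Longrightarrow> defect (4 * int t + 1) n B i j = v i * v j"
    "\<And>i. i < n \<Longrightarrow> (\<Sum>l<n. B i l * v l) = 0" "(\<Sum>i<n. v i * v i) = 4 * int t + 1"
proof -
  let ?m = "4 * int t + 1"
  define P where "P = defect ?m n B"
  have rP: "represents P (\<lambda>x. real_of_int ?m - x * x)" unfolding P_def by (rule represents_defect)
  have sym: "P i j = P j i" if "i < n" "j < n" for i j by (rule represents_sym[OF rP that])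
  have diag: "P i i = 1" if "i < n" for i unfolding P_def defect_diag[OF B that] using n by simp
  have odd: "odd (P i j)" if "i < n" "j < n" for i j
    using diag[of i] even_defect_iff[OF B that, of ?m] that n unfolding P_def by (cases "i = j") auto
  have sq: "(\<Sum>k<n. P i k * P k j) = ?m * P i j" if "i < n" "j < n" for i j
    by (rule represents_eqI[OF represents_mult[OF rP rP] represents_scale[OF rP] _ that])
      (use spec in fastforce)
  have BP: "(\<Sum>k<n. B i k * P k j) = 0" if "i < n" "j < n" for i j
    by (rule represents_eqI[OF represents_mult[OF represents_self rP] represents_zero _ that])
      (use spec in fastforce)
  obtain v where v: "\<And>i. i < n \<Longrightarrow> v i \<in> {1, -1}" "\<And>i j. \<lbrakk>i < n; j < n\<rbrakk> \<Longrightarrow> P i j = v i * v j"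
    using rank_one_sign_gram[OF sym diag sq _ odd] n by auto
  have "(\<Sum>l<n. B i l * v l) = 0" if i: "i < n" for i
  proof -
    have "(\<Sum>k<n. B i k * P k i) = (\<Sum>l<n. B i l * v l) * v i"
      unfolding sum_distrib_right using v(2) i by (intro sum.cong) auto
    thus ?thesis using BP[OF i i] v(1)[OF i] by auto
  qed
  moreover have "(\<Sum>i<n. v i * v i) = ?m"
  proof -
    have "(\<Sum>i<n. v i * v i) = (\<Sum>i<n. 1)" using v(1) by (intro sum.cong) fastforce+
    thus ?thesis using n by simp
  qed
  ultimately show thesis using that v unfolding P_def by blast
qed

text \<open>With \<open>P = 2 (u u\<^sup>T + w w\<^sup>T)\<close> the new columns are \<open>u + w\<close> and \<open>u - w\<close>. \<open>B\<close> acts on the span of \<open>u\<close> and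
  \<open>w\<close> as a symmetric orthogonal matrix of trace 0; a parity argument makes it diagonal in the basis \<open>u, w\<close>,
  so that it interchanges the new columns up to sign.\<close>

lemma add_two_vertices:
  assumes B: "seidel_fun n B" and n: "n = 4 * t" and t: "t > 0"
    and e0: "e 0 = 1" and e1: "e 1 = -1"
    and spec: "\<And>k. \<lbrakk>k < n; k \<noteq> 0; k \<noteq> 1\<rbrakk> \<Longrightarrow> e k * e k = real (4 * t + 1)"
  obtains C D where "seidel_fun 2 D" "\<And>i x. \<lbrakk>i < n; x < 2\<rbrakk> \<Longrightarrow> C i x \<in> {1, -1}"
    "\<And>i j. \<lbrakk>i < n; j < n\<rbrakk> \<Longrightarrow> defect (4 * int t + 1) n B i j = (\<Sum>x<2. C i x * C j x)"
    "\<And>i x. \<lbrakk>i < n; x < 2\<rbrakk> \<Longrightarrow> (\<Sum>l<n. B i l * C l x) = - (\<Sum>y<2. C i y * D y x)"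
    "\<And>x y. \<lbrakk>x < 2; y < 2\<rbrakk> \<Longrightarrow> (\<Sum>i<n. C i x * C i y) + (\<Sum>z<2. D x z * D z y)
      = (if x = y then 4 * int t + 1 else 0)"
proof -
  let ?m = "4 * int t + 1"
  define P where "P = defect ?m n B"
  have rP: "represents P (\<lambda>x. real_of_int ?m - x * x)" unfolding P_def by (rule represents_defect)
  have spec': "e k = 1 \<or> e k = -1 \<or> e k * e k = real_of_int ?m" if "k < n" for k
    using spec[OF that] e0 e1 by (cases "k = 0"; cases "k = 1") auto
  have symP: "P i j = P j i" if "i < n" "j < n" for i j by (rule represents_sym[OF rP that])
  have diagP: "P i i = 2" if "i < n" for i unfolding P_def defect_diag[OF B that] using n by simp
  have even: "even (P i j)" if "i < n" "j < n" for i j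
    using diagP[of i] even_defect_iff[OF B that, of ?m] that n unfolding P_def by (cases "i = j") auto
  have sqP: "(\<Sum>k<n. P i k * P k j) = (4 * int t) * P i j" if "i < n" "j < n" for i j
    by (rule represents_eqI[OF represents_mult[OF rP rP] represents_scale[OF rP] _ that])
      (use spec' in fastforce)
  have commP: "(\<Sum>k<n. B i k * P k j) = (\<Sum>k<n. P i k * B k j)" if "i < n" "j < n" for i j
    by (rule represents_eqI[OF represents_mult[OF represents_self rP] represents_mult[OF rP represents_self] _ that])
      simp
  \<comment> \<open>\<open>B^2\<close> acts as the identity on the range of \<open>P\<close>,
    because \<open>m - x^2\<close> is nonzero only at the eigenvalues 1 and -1.\<close>
  have BBP: "(\<Sum>k<n. B i k * (\<Sum>l<n. B k l * P l j)) = P i j" if "i < n" "j < n" for i j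
    by (rule represents_eqI[OF represents_mult[OF represents_self represents_mult[OF represents_self rP]] rP _ that])
      (use spec' in fastforce)
  have "real_of_int (\<Sum>i<n. \<Sum>k<n. B i k * P k i) = (\<Sum>k<n. e k * (real_of_int ?m - e k * e k))"
    by (rule trace_represents[OF represents_mult[OF represents_self rP]])
  also have "\<dots> = (\<Sum>k\<in>{0,1}. e k * (real_of_int ?m - e k * e k))"
    by (rule sum.mono_neutral_right) (use spec n t in auto)
  also have "\<dots> = 0" using e0 e1 by simp
  finally have traceP: "(\<Sum>i<n. \<Sum>k<n. B i k * P k i) = 0" by (simp only: of_int_eq_0_iff)
  define Q where "Q i j = P i j div 2" for i j
  have PQ: "P i j = 2 * Q i j" if "i < n" "j < n" for i j using even[OF that] unfolding Q_def by simp
  have symQ: "Q i j = Q j i" if "i < n" "j < n" for i j using symP[OF that] unfolding Q_def by simp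
  have diagQ: "Q i i = 1" if "i < n" for i using diagP[OF that] unfolding Q_def by simp
  have sqQ: "(\<Sum>k<n. Q i k * Q k j) = 2 * int t * Q i j" if ij: "i < n" "j < n" for i j
  proof -
    have "(\<Sum>k<n. P i k * P k j) = 4 * (\<Sum>k<n. Q i k * Q k j)"
      unfolding sum_distrib_left using ij by (intro sum.cong) (auto simp: PQ)
    thus ?thesis using sqP[OF ij] PQ[OF ij] by simp
  qed
  have scale: "(\<Sum>k<n. f k * P k j) = 2 * (\<Sum>k<n. f k * Q k j)" if "j < n" for f j
    unfolding sum_distrib_left using that by (intro sum.cong) (auto simp: PQ)
  obtain u w p q where pq: "p < n" "q < n" "u p = 1" "u q = 0" "w p = 0" "w q = 1"
    and u: "\<And>i. i < n \<Longrightarrow> u i \<in> {0,1,-1}" and w: "\<And>i. i < n \<Longrightarrow> w i \<in> {0,1,-1}"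
    and disj: "\<And>i. i < n \<Longrightarrow> (u i = 0) = (w i \<noteq> 0)"
    and Q: "\<And>i j. \<lbrakk>i < n; j < n\<rbrakk> \<Longrightarrow> Q i j = u i * u j + w i * w j"
    and norm: "(\<Sum>i<n. u i * u i) = 2 * int t" "(\<Sum>i<n. w i * w i) = 2 * int t"
    by (rule rank_two_gram[OF symQ diagQ sqQ n t], assumption+) (rule that)
  define Bu Bw where "Bu i = (\<Sum>k<n. B i k * u k)" and "Bw i = (\<Sum>k<n. B i k * w k)" for i
  have BQ: "(\<Sum>k<n. B i k * Q k j) = Bu i * u j + Bw i * w j" if "i < n" "j < n" for i j
    unfolding Bu_def Bw_def sum_distrib_right sum.distrib[symmetric]
    using that by (intro sum.cong) (auto simp: Q algebra_simps)
  have QB: "(\<Sum>k<n. Q i k * B k j) = u i * Bu j + w i * Bw j" if "i < n" "j < n" for i j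
    unfolding Bu_def Bw_def sum_distrib_left sum.distrib[symmetric]
    using that seidel_funD(2)[OF B, of _ j] by (intro sum.cong) (auto simp: Q algebra_simps)
  have comm: "Bu i * u j + Bw i * w j = u i * Bu j + w i * Bw j" if ij: "i < n" "j < n" for i j
  proof -
    have "(\<Sum>k<n. P i k * B k j) = 2 * (\<Sum>k<n. Q i k * B k j)"
      unfolding sum_distrib_left using ij by (intro sum.cong) (auto simp: PQ)
    thus ?thesis using commP[OF ij] scale[OF ij(2), of "B i"] BQ[OF ij] QB[OF ij] by simp
  qed
  \<comment> \<open>The matrix of \<open>B\<close> on the span of \<open>u\<close> and
    \<open>w\<close>, with rows \<open>(a, b)\<close> and \<open>(b, d)\<close>. It is read off at
    \<open>p\<close> and \<open>q\<close>, where \<open>(u, w)\<close> is \<open>(1, 0)\<close> and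
    \<open>(0, 1)\<close>; that \<open>B\<close> commutes with \<open>P\<close> makes the span
    invariant and the matrix symmetric.\<close>
  define a b d where "a = Bu p" and "b = Bw p" and "d = Bw q"
  have Bu: "Bu i = a * u i + b * w i" if "i < n" for i
    using comm[OF that pq(1)] pq unfolding a_def b_def by simp
  have Bw: "Bw i = b * u i + d * w i" if "i < n" for i
    using comm[OF that pq(2)] Bu[OF pq(2)] pq unfolding d_def by simp
  have BBQ: "(\<Sum>k<n. B i k * (Bu k * u j + Bw k * w j)) = Q i j" if ij: "i < n" "j < n" for i j
  proof -
    have "P i j = (\<Sum>k<n. B i k * (2 * (Bu k * u j + Bw k * w j)))"
      unfolding BBP[OF ij, symmetric] using scale[OF ij(2)] BQ[OF _ ij(2)] by simp
    also have "\<dots> = 2 * (\<Sum>k<n. B i k * (Bu k * u j + Bw k * w j))"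
      unfolding sum_distrib_left by (intro sum.cong) auto
    finally show ?thesis using PQ[OF ij] by simp
  qed
  have B_comb: "(\<Sum>k<n. B i k * (x * u k + y * w k)) = x * Bu i + y * Bw i" for i x y
    unfolding Bu_def Bw_def sum_distrib_left sum.distrib[symmetric]
    by (intro sum.cong) (auto simp: algebra_simps)
  have "(\<Sum>k<n. B p k * Bu k) = 1" using BBQ[OF pq(1) pq(1)] diagQ pq by simp
  hence "(\<Sum>k<n. B p k * (a * u k + b * w k)) = 1" using Bu by simp
  hence ab: "a * a + b * b = 1" unfolding B_comb a_def[symmetric] b_def[symmetric] .
  \<comment> \<open>Modulo 2, \<open>a\<close> counts the indices other than \<open>p\<close> in the
    support of \<open>u\<close>, of which there are \<open>2t - 1\<close>. Being odd with
    \<open>a^2 + b^2 = 1\<close>, it is a sign and \<open>b = 0\<close>.\<close>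
  have "even (\<Sum>k<n. B p k * u k - u k * u k + (if k = p then 1 else 0))"
  proof (rule dvd_sum)
    fix k assume k: "k \<in> {..<n}"
    show "even (B p k * u k - u k * u k + (if k = p then 1 else 0))"
      using seidel_funD(1)[OF B, of p] seidel_funD(3)[OF B, of p k] u[of k] k pq by (cases "k = p") auto
  qed
  hence "odd a" using norm pq unfolding a_def Bu_def by (simp add: sum.distrib sum_subtractf)
  have "a * a \<le> 1" using ab by (smt (verit) zero_le_square)
  hence "\<bar>a\<bar> \<le> 1" by (metis abs_ge_zero abs_mult_self_eq abs_one abs_square_le_1 power2_eq_square)
  hence a: "a = 1 \<or> a = -1" using \<open>odd a\<close> by (auto simp: abs_le_iff) presburger
  hence b: "b = 0" using ab by auto
  have "(\<Sum>i<n. \<Sum>k<n. B i k * P k i) = (\<Sum>i<n. 2 * (a * (u i * u i) + d * (w i * w i)))"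
  proof (rule sum.cong)
    fix i assume "i \<in> {..<n}"
    thus "(\<Sum>k<n. B i k * P k i) = 2 * (a * (u i * u i) + d * (w i * w i))"
      using scale[of i "B i"] BQ[of i i] Bu[of i] Bw[of i] b by (simp add: mult_ac)
  qed simp
  also have "\<dots> = 2 * (a * (\<Sum>i<n. u i * u i) + d * (\<Sum>i<n. w i * w i))"
    unfolding sum_distrib_left sum.distrib[symmetric] by (simp only: sum_distrib_left)
  also have "\<dots> = 2 * (a * (2 * int t) + d * (2 * int t))" by (simp only: norm)
  finally have d: "d = - a" using traceP t by (simp flip: distrib_right)
  have cross: "(\<Sum>i<n. u i * w i) = 0" by (rule sum.neutral) (use disj in auto)
  define C :: "nat \<Rightarrow> nat \<Rightarrow> int" where "C i x = (if x = 0 then u i + w i else u i - w i)" for i x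
  \<comment> \<open>Since \<open>B\<close> multiplies \<open>u\<close> by \<open>a\<close> and
    \<open>w\<close> by \<open>-a\<close>, it sends \<open>u + w\<close> to \<open>a (u - w)\<close>
    and conversely; \<open>BC = -CD\<close> then dictates the entry \<open>-a\<close>.\<close>
  define D :: "nat \<Rightarrow> nat \<Rightarrow> int" where "D x y = (if x = y then 0 else - a)" for x y
  have two: "x = 0 \<or> x = 1" if "x < 2" for x :: nat using that by auto
  have sum2: "(\<Sum>x<2. f x) = f 0 + f 1" for f :: "nat \<Rightarrow> int" by (simp add: lessThan_nat_numeral)
  have BC0: "(\<Sum>l<n. B i l * (u l + w l)) = a * u i - a * w i"
    and BC1: "(\<Sum>l<n. B i l * (u l - w l)) = a * u i + a * w i" if "i < n" for i
    using B_comb[of i 1 1] B_comb[of i 1 "-1"] Bu[OF that] Bw[OF that] b d by simp_all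
  have "(\<Sum>i<n. (u i + w i) * (u i + w i)) = (\<Sum>i<n. u i * u i) + (\<Sum>i<n. w i * w i) + 2 * (\<Sum>i<n. u i * w i)"
    "(\<Sum>i<n. (u i - w i) * (u i - w i)) = (\<Sum>i<n. u i * u i) + (\<Sum>i<n. w i * w i) - 2 * (\<Sum>i<n. u i * w i)"
    "(\<Sum>i<n. (u i + w i) * (u i - w i)) = (\<Sum>i<n. u i * u i) - (\<Sum>i<n. w i * w i)"
    unfolding sum_distrib_left sum.distrib[symmetric] sum_subtractf[symmetric]
    by (auto intro!: sum.cong simp: algebra_simps)
  hence CC: "(\<Sum>i<n. (u i + w i) * (u i + w i)) = 4 * int t" "(\<Sum>i<n. (u i - w i) * (u i - w i)) = 4 * int t"
    "(\<Sum>i<n. (u i + w i) * (u i - w i)) = 0"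
    unfolding norm cross by simp_all
  show thesis
  proof (rule that[of D C])
    show "seidel_fun 2 D" unfolding seidel_fun_def D_def using a by auto
    show "C i x \<in> {1, -1}" if "i < n" "x < 2" for i x
      using u[OF that(1)] w[OF that(1)] disj[OF that(1)] unfolding C_def by auto
    show "defect ?m n B i j = (\<Sum>x<2. C i x * C j x)" if "i < n" "j < n" for i j
      using PQ[OF that] Q[OF that] unfolding P_def sum2 C_def by (simp add: algebra_simps)
    show "(\<Sum>l<n. B i l * C l x) = - (\<Sum>y<2. C i y * D y x)" if "i < n" "x < 2" for i x
      using two[OF that(2)] BC0[OF that(1)] BC1[OF that(1)] unfolding C_def D_def sum2
      by (auto simp: algebra_simps)
    show "(\<Sum>i<n. C i x * C i y) + (\<Sum>z<2. D x z * D z y) = (if x = y then ?m else 0)"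
      if "x < 2" "y < 2" for x y
      using two[OF that(1)] two[OF that(2)] CC a unfolding C_def D_def sum2
      by (auto simp: mult.commute[of "u _ - w _" "u _ + w _"])
  qed
qed

text \<open>Here \<open>(B + I) P = z z\<^sup>T\<close> is \<open>12t - 9\<close> times the projection onto the eigenvector of eigenvalue 2,
  and bordering \<open>P\<close> by \<open>z\<close> and the entry 3 turns it into \<open>4t\<close> times a projection of rank 3. The
  sign of \<open>z\<close> and its integrality come from a diagonal entry 1 of \<open>z z\<^sup>T\<close>: all of them are
  congruent to 1 modulo 8 and their sum \<open>12t - 9\<close> is too small for all of them to be at least 9.\<close>

lemma bordered_defect:
  assumes B: "seidel_fun n B" and n: "n + 1 = 4 * t" and t: "t > 0" and e0: "e 0 = 2"
    and spec: "\<And>k. \<lbrakk>k < n; k \<noteq> 0\<rbrakk> \<Longrightarrow> e k = -1 \<or> e k * e k = real (4 * t + 1)"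
  defines "P \<equiv> defect (4 * int t + 1) n B"
  obtains z where "\<And>i. i < n \<Longrightarrow> odd (z i)" "\<And>i. i < n \<Longrightarrow> P i i = 3"
    "\<And>i j. \<lbrakk>i < n; j < n\<rbrakk> \<Longrightarrow> odd (P i j)" "\<And>i j. \<lbrakk>i < n; j < n\<rbrakk> \<Longrightarrow> P i j = P j i"
    "\<And>i j. \<lbrakk>i < n; j < n\<rbrakk> \<Longrightarrow> (\<Sum>k<n. B i k * P k j) = z i * z j - P i j"
    "\<And>i j. \<lbrakk>i < n; j < n\<rbrakk> \<Longrightarrow> (\<Sum>k<n. P i k * P k j) + z i * z j = 4 * int t * P i j"
    "\<And>i. i < n \<Longrightarrow> (\<Sum>k<n. P i k * z k) + z i * 3 = 4 * int t * z i"
    "(\<Sum>k<n. z k * z k) + 9 = 12 * int t"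
proof -
  let ?m = "4 * int t + 1"
  define F where "F i j = (\<Sum>k<n. B i k * P k j) + P i j" for i j
  have rP: "represents P (\<lambda>x. real_of_int ?m - x * x)" unfolding P_def by (rule represents_defect)
  have rF: "represents F (\<lambda>x. x * (real_of_int ?m - x * x) + (real_of_int ?m - x * x))"
    unfolding F_def[abs_def] by (intro represents_add represents_mult represents_self rP)
  have spec': "e k = 2 \<or> e k = -1 \<or> e k * e k = real_of_int ?m" if "k < n" for k
    using spec[OF that] e0 by (cases "k = 0") auto
  have sym: "P i j = P j i" if "i < n" "j < n" for i j by (rule represents_sym[OF rP that])
  have diag: "P i i = 3" if "i < n" for i
  proof -
    have "int n + 1 = 4 * int t" using n by linarith
    thus ?thesis unfolding P_def defect_diag[OF B that] by simp
  qed
  have "odd n" using n by presburger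
  hence odd: "odd (P i j)" if "i < n" "j < n" for i j
    using diag[of i] even_defect_iff[OF B that, of ?m] that unfolding P_def by (cases "i = j") auto
  \<comment> \<open>\<open>F\<close> corresponds to \<open>(x + 1)(m - x^2)\<close>, which is
    \<open>12t - 9\<close> at 2 and 0 at all other eigenvalues. At 2 the claim reads
    \<open>(4t - 3)^2 + 3 (4t - 3) = 4t (4t - 3)\<close>. Together with \<open>PF\<close> and
    \<open>FF\<close> it supplies the blocks of the equation for the square of the bordered
    matrix.\<close>
  have PP: "(\<Sum>k<n. P i k * P k j) + F i j = (4 * int t) * P i j" if "i < n" "j < n" for i j
    by (rule represents_eqI[OF represents_add[OF represents_mult[OF rP rP] rF] represents_scale[OF rP] _ that])
      (use spec' in \<open>fastforce simp: algebra_simps\<close>)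
  have PF: "(\<Sum>k<n. P i k * F k j) + 3 * F i j = (4 * int t) * F i j" if "i < n" "j < n" for i j
    by (rule represents_eqI[OF represents_add[OF represents_mult[OF rP rF] represents_scale[OF rF, of 3]]
        represents_scale[OF rF] _ that])
      (use spec' in \<open>fastforce simp: algebra_simps\<close>)
  have FF: "(\<Sum>k<n. F i k * F k j) = (12 * int t - 9) * F i j" if "i < n" "j < n" for i j
    by (rule represents_eqI[OF represents_mult[OF rF rF] represents_scale[OF rF] _ that])
      (use spec' in \<open>fastforce simp: algebra_simps\<close>)
  have rank1: "F i j * F p q = F i q * F p j" if "i < n" "j < n" "p < n" "q < n" for i j p q
    by (rule represents_rank_one[OF rF _ that]) (use spec in \<open>fastforce simp: algebra_simps\<close>)
  have symF: "F i j = F j i" if "i < n" "j < n" for i j by (rule represents_sym[OF rF that])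
  have n0: "0 < n" using n t by presburger
  have "real_of_int (\<Sum>i<n. F i i) = (\<Sum>k<n. e k * (real_of_int ?m - e k * e k) + (real_of_int ?m - e k * e k))"
    by (rule trace_represents[OF rF])
  also have "\<dots> = (\<Sum>k\<in>{0}. e k * (real_of_int ?m - e k * e k) + (real_of_int ?m - e k * e k))"
    by (rule sum.mono_neutral_right) (use spec n0 in \<open>fastforce simp: algebra_simps\<close>)+
  also have "\<dots> = real_of_int (12 * int t - 9)" using e0 by simp
  finally have traceF: "(\<Sum>i<n. F i i) = 12 * int t - 9" by (simp only: of_int_eq_iff)
  \<comment> \<open>Odd squares are 1 modulo 8, so the diagonal entry of \<open>P^2\<close> is
    congruent to \<open>n = 4t - 1\<close>, and \<open>F i i\<close> is 12t minus that entry, hence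
    congruent to \<open>8t + 1\<close>.\<close>
  have mod8: "F i i mod 8 = 1" if i: "i < n" for i
  proof -
    have "(\<Sum>k<n. P i k * P k i) mod 8 = (\<Sum>k<n. (P i k * P k i) mod 8) mod 8" by (rule mod_sum_eq[symmetric])
    also have "(\<Sum>k<n. (P i k * P k i) mod 8) = (\<Sum>k<n. 1)"
    proof (rule sum.cong)
      fix k assume k: "k \<in> {..<n}"
      obtain l where l: "P i k = 2 * l + 1" using odd[OF i, of k] k by (auto elim: oddE)
      have "even (l * (l + 1))" by simp
      then obtain h where "l * (l + 1) = 2 * h" by (rule evenE)
      moreover have "P i k * P k i = 4 * (l * (l + 1)) + 1"
        using l sym[of k i] i k by (simp add: algebra_simps)
      ultimately have "P i k * P k i = 8 * h + 1" by simp
      thus "(P i k * P k i) mod 8 = 1" by presburger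
    qed simp
    finally have "(\<Sum>k<n. P i k * P k i) mod 8 = int n mod 8" by simp
    then obtain q where "(\<Sum>k<n. P i k * P k i) - int n = 8 * q"
      unfolding mod_eq_dvd_iff by (rule dvdE)
    moreover have "(\<Sum>k<n. P i k * P k i) + F i i = 12 * int t" using PP[OF i i] diag[OF i] by simp
    moreover have "int n = 4 * int t - 1" using n by linarith
    ultimately have "F i i = 1 + 8 * (int t - q)" by simp
    thus ?thesis by presburger
  qed
  have pos: "F i i \<ge> 1" if i: "i < n" for i
  proof -
    have "0 \<le> (\<Sum>k<n. F i k * F k i)"
    proof (rule sum_nonneg)
      fix k assume "k \<in> {..<n}"
      thus "0 \<le> F i k * F k i" using symF[OF i, of k] by simp
    qed
    hence "0 \<le> (12 * int t - 9) * F i i" unfolding FF[OF i i] .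
    moreover have "0 < 12 * int t - 9" using t by simp
    ultimately have "0 \<le> F i i" by (simp only: zero_le_mult_iff) linarith
    moreover have "F i i \<noteq> 0" using mod8[OF i] by auto
    ultimately show ?thesis by linarith
  qed
  have "\<exists>i<n. F i i = 1"
  proof (rule ccontr)
    assume no: "\<not> ?thesis"
    have "(\<Sum>i<n. (9::int)) \<le> (\<Sum>i<n. F i i)"
    proof (rule sum_mono)
      fix i assume i: "i \<in> {..<n}"
      hence "F i i \<noteq> 1" "F i i \<ge> 1" "F i i mod 8 = 1" using no pos mod8 by auto
      thus "9 \<le> F i i" by presburger
    qed
    thus False using traceF n t by simp
  qed
  then obtain r where r: "r < n" "F r r = 1" by blast
  \<comment> \<open>A unit diagonal entry turns the vanishing minors into
    \<open>F i j = F i r * F r j\<close>, so column \<open>r\<close> is an integral factor.\<close>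
  define z where "z i = F i r" for i
  have F: "F i j = z i * z j" if "i < n" "j < n" for i j
    using rank1[OF that r(1) r(1)] r symF[OF that(2) r(1)] unfolding z_def by simp
  have "odd (z i)" if i: "i < n" for i
  proof -
    have "(z i * z i) mod 8 = 1" using mod8[OF i] F[OF i i] by simp
    moreover have "odd x" if "x mod 8 = 1" for x :: int using that by presburger
    ultimately have "odd (z i * z i)" by blast
    thus ?thesis by simp
  qed
  moreover have "(\<Sum>k<n. P i k * z k) + z i * 3 = 4 * int t * z i" if "i < n" for i
    using PF[OF that r(1)] unfolding z_def by simp
  moreover have "(\<Sum>k<n. z k * z k) + 9 = 12 * int t"
  proof -
    have "(\<Sum>k<n. F r k * F k r) = (\<Sum>k<n. z k * z k)"
      using symF r unfolding z_def by (intro sum.cong) auto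
    thus ?thesis using FF[OF r(1) r(1)] r by simp
  qed
  moreover have "(\<Sum>k<n. B i k * P k j) = z i * z j - P i j" if "i < n" "j < n" for i j
    using F[OF that] unfolding F_def by simp
  moreover have "(\<Sum>k<n. P i k * P k j) + z i * z j = 4 * int t * P i j" if "i < n" "j < n" for i j
    using PP[OF that] F[OF that] by simp
  ultimately show thesis using that diag odd sym by blast
qed

text \<open>\<open>cube_diagonals_gram\<close> applies to the bordered matrix of order
  \<open>n + 1 = 4t\<close>, normalized so that the extra row of \<open>C\<close> is
  \<open>(1,1,1)\<close>; hence \<open>z\<close> is the sum of the columns of \<open>C\<close>.
  Without that row \<open>C^T C = 4t I - J\<close>, with \<open>J\<close> the all-ones matrix, and
  \<open>D = I - J\<close> has \<open>D^2 = I + J\<close>, so the two add up to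
  \<open>mI\<close>.\<close>

lemma add_three_vertices:
  assumes B: "seidel_fun n B" and n: "n + 1 = 4 * t" and t: "t > 0" and e0: "e 0 = 2"
    and spec: "\<And>k. \<lbrakk>k < n; k \<noteq> 0\<rbrakk> \<Longrightarrow> e k = -1 \<or> e k * e k = real (4 * t + 1)"
  defines "D \<equiv> \<lambda>x y :: nat. if x = y then 0 else - 1 :: int"
  obtains C where "\<And>i x. \<lbrakk>i < n; x < 3\<rbrakk> \<Longrightarrow> C i x \<in> {1, -1}"
    "\<And>i j. \<lbrakk>i < n; j < n\<rbrakk> \<Longrightarrow> defect (4 * int t + 1) n B i j = (\<Sum>x<3. C i x * C j x)"
    "\<And>i x. \<lbrakk>i < n; x < 3\<rbrakk> \<Longrightarrow> (\<Sum>l<n. B i l * C l x) = - (\<Sum>y<3. C i y * D y x)"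
    "\<And>x y. \<lbrakk>x < 3; y < 3\<rbrakk> \<Longrightarrow> (\<Sum>i<n. C i x * C i y) + (\<Sum>z<3. D x z * D z y)
      = (if x = y then 4 * int t + 1 else 0)"
proof -
  let ?m = "4 * int t + 1"
  define P where "P = defect ?m n B"
  obtain z where zodd: "\<And>i. i < n \<Longrightarrow> odd (z i)" and diag: "\<And>i. i < n \<Longrightarrow> P i i = 3"
    and Podd: "\<And>i j. \<lbrakk>i < n; j < n\<rbrakk> \<Longrightarrow> odd (P i j)" and sym: "\<And>i j. \<lbrakk>i < n; j < n\<rbrakk> \<Longrightarrow> P i j = P j i"
    and BP: "\<And>i j. \<lbrakk>i < n; j < n\<rbrakk> \<Longrightarrow> (\<Sum>k<n. B i k * P k j) = z i * z j - P i j"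
    and PP: "\<And>i j. \<lbrakk>i < n; j < n\<rbrakk> \<Longrightarrow> (\<Sum>k<n. P i k * P k j) + z i * z j = 4 * int t * P i j"
    and Pz: "\<And>i. i < n \<Longrightarrow> (\<Sum>k<n. P i k * z k) + z i * 3 = 4 * int t * z i"
    and zz: "(\<Sum>k<n. z k * z k) + 9 = 12 * int t"
    by (rule bordered_defect[OF B n t e0 spec, folded P_def], assumption+) (rule that)
  \<comment> \<open>Index \<open>n\<close> is the temporary border. It is discarded once
    \<open>C\<close> is found and is not one of the new vertices.\<close>
  define P' where "P' i j = (if i < n then if j < n then P i j else z i else if j < n then z j else 3)" for i j
  have n': "Suc n = 4 * t" using n by simp
  have P'_sym: "P' i j = P' j i" if "i < Suc n" "j < Suc n" for i j unfolding P'_def using sym by auto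
  have P'_diag: "P' i i = 3" if "i < Suc n" for i unfolding P'_def using diag by auto
  have P'_odd: "odd (P' i j)" if "i < Suc n" "j < Suc n" for i j
    unfolding P'_def using zodd Podd by auto
  have P'_sq: "(\<Sum>k<Suc n. P' i k * P' k j) = 4 * int t * P' i j" if "i < Suc n" "j < Suc n" for i j
  proof -
    have "(\<Sum>k<Suc n. P' i k * P' k j) = (\<Sum>k<n. (if i < n then P i k else z k) * (if j < n then P k j else z k))
        + (if i < n then z i else 3) * (if j < n then z j else 3)"
      unfolding P'_def sum.lessThan_Suc by simp
    also have "\<dots> = 4 * int t * P' i j"
    proof (cases "i < n"; cases "j < n")
      assume "i < n" "j < n"
      thus ?thesis using PP unfolding P'_def by simp
    next
      assume "i < n" "\<not> j < n"
      thus ?thesis using Pz unfolding P'_def by simp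
    next
      assume ij: "\<not> i < n" "j < n"
      have "(\<Sum>k<n. z k * P k j) = (\<Sum>k<n. P j k * z k)"
        using sym ij by (intro sum.cong) auto
      thus ?thesis using Pz ij unfolding P'_def by (simp add: mult.commute)
    next
      assume "\<not> i < n" "\<not> j < n"
      thus ?thesis using zz unfolding P'_def by simp
    qed
    finally show ?thesis .
  qed
  obtain C :: "nat \<Rightarrow> nat \<Rightarrow> int" where C_pm: "\<And>i x. \<lbrakk>i < Suc n; x < 3\<rbrakk> \<Longrightarrow> C i x \<in> {1, -1}"
    and C_n: "\<And>x. x < 3 \<Longrightarrow> C n x = 1"
    and C_gram: "\<And>i j. \<lbrakk>i < Suc n; j < Suc n\<rbrakk> \<Longrightarrow> P' i j = (\<Sum>x<3. C i x * C j x)"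
    and C_orth: "\<And>x y. \<lbrakk>x < 3; y < 3\<rbrakk> \<Longrightarrow> (\<Sum>i<Suc n. C i x * C i y) = (if x = y then 4 * int t else 0)"
    by (rule cube_diagonals_gram[OF P'_sym P'_diag P'_sq P'_odd n' t lessI], assumption+) (rule that)
  have sum3: "(\<Sum>x<3. f x) = f 0 + f 1 + f 2" for f :: "nat \<Rightarrow> int" by (simp add: lessThan_nat_numeral)
  have three: "x = 0 \<or> x = 1 \<or> x = 2" if "x < 3" for x :: nat using that by auto
  have P: "P i j = (\<Sum>x<3. C i x * C j x)" if "i < n" "j < n" for i j
    using C_gram[of i j] that unfolding P'_def by simp
  have z: "z i = (\<Sum>x<3. C i x)" if "i < n" for i
    using C_gram[of i n] that C_n unfolding P'_def by (simp add: sum3)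
  have orth: "(\<Sum>i<n. C i x * C i y) = (if x = y then 4 * int t else 0) - 1" if "x < 3" "y < 3" for x y
    using C_orth[OF that] C_n that by simp
  have orth_sum: "(\<Sum>x<3. f x * (\<Sum>j<n. C j x * C j y)) = 4 * int t * f y - (f 0 + f 1 + f 2)"
    if y: "y < 3" for f :: "nat \<Rightarrow> int" and y
  proof -
    have "(\<Sum>x<3. f x * (\<Sum>j<n. C j x * C j y)) = (\<Sum>x<3. f x * ((if x = y then 4 * int t else 0) - 1))"
      by (rule sum.cong) (use orth y in auto)
    thus ?thesis unfolding sum3 using three[OF y] by (auto simp: algebra_simps)
  qed
  have BC: "(\<Sum>l<n. B i l * C l y) = z i - C i y" if i: "i < n" and y: "y < 3" for i y
  proof -
    define K where "K x = (\<Sum>l<n. B i l * C l x)" for x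
    have KC: "(\<Sum>x<3. K x * C j x) = z i * z j - P i j" if j: "j < n" for j
    proof -
      have "(\<Sum>l<n. B i l * P l j) = (\<Sum>x<3. K x * C j x)"
        unfolding K_def sum_distrib_right sum3 sum.distrib[symmetric]
        using j by (intro sum.cong) (auto simp: P sum3 algebra_simps)
      thus ?thesis using BP[OF i j] by simp
    qed
    have eq: "4 * int t * K y - (K 0 + K 1 + K 2) = (4 * int t - 2) * z i - 4 * int t * C i y"
      if y: "y < 3" for y
    proof -
      have "(\<Sum>j<n. (\<Sum>x<3. K x * C j x) * C j y) = (\<Sum>x<3. K x * (\<Sum>j<n. C j x * C j y))"
        unfolding sum3 sum_distrib_left sum.distrib[symmetric]
        by (intro sum.cong) (auto simp: algebra_simps)
      also have "\<dots> = 4 * int t * K y - (K 0 + K 1 + K 2)"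
        by (rule orth_sum[OF y])
      finally have 1: "(\<Sum>j<n. (\<Sum>x<3. K x * C j x) * C j y) = 4 * int t * K y - (K 0 + K 1 + K 2)" .
      have "(\<Sum>j<n. (\<Sum>x<3. K x * C j x) * C j y) = (\<Sum>j<n. (\<Sum>x<3. (z i - C i x) * C j x) * C j y)"
      proof (rule sum.cong)
        fix j assume "j \<in> {..<n}"
        hence j: "j < n" by simp
        have "(\<Sum>x<3. K x * C j x) = (\<Sum>x<3. (z i - C i x) * C j x)"
          unfolding KC[OF j] P[OF i j] z[OF j] sum3 by (simp add: algebra_simps)
        thus "(\<Sum>x<3. K x * C j x) * C j y = (\<Sum>x<3. (z i - C i x) * C j x) * C j y" by simp
      qed simp
      also have "\<dots> = (\<Sum>x<3. (z i - C i x) * (\<Sum>j<n. C j x * C j y))"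
        unfolding sum3 sum_distrib_left sum.distrib[symmetric]
        by (intro sum.cong) (auto simp: algebra_simps)
      also have "\<dots> = 4 * int t * (z i - C i y) - (3 * z i - z i)"
        unfolding orth_sum[OF y] z[OF i] sum3 by (simp add: algebra_simps)
      finally show ?thesis using 1 by (simp add: algebra_simps)
    qed
    \<comment> \<open>The columns of \<open>C\<close> are not orthogonal on the first
      \<open>n\<close> rows, so \<open>eq\<close> couples the unknowns \<open>K 0\<close>,
      \<open>K 1\<close>, \<open>K 2\<close>. Adding the three equations determines their sum, as
      \<open>4t - 3\<close> is nonzero, and then each of them.\<close>
    have "(4 * int t - 3) * (K 0 + K 1 + K 2) = (4 * int t - 3) * (2 * z i)"
      using eq[of 0] eq[of 1] eq[of 2] z[OF i] by (simp add: sum3 algebra_simps)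
    hence "K 0 + K 1 + K 2 = 2 * z i" using t by simp
    hence "int t * K y = int t * (z i - C i y)" using eq[OF y] by (simp add: algebra_simps)
    thus ?thesis using t unfolding K_def by simp
  qed
  show thesis
  proof (rule that[of C])
    show "C i x \<in> {1, -1}" if "i < n" "x < 3" for i x using C_pm that by simp
    show "defect ?m n B i j = (\<Sum>x<3. C i x * C j x)" if "i < n" "j < n" for i j
      using P[OF that] unfolding P_def .
    show "(\<Sum>l<n. B i l * C l x) = - (\<Sum>y<3. C i y * D y x)" if "i < n" "x < 3" for i x
      using BC[OF that] three[OF that(2)] z[OF that(1)] unfolding D_def sum3 by auto
    show "(\<Sum>i<n. C i x * C i y) + (\<Sum>z<3. D x z * D z y) = (if x = y then ?m else 0)"
      if "x < 3" "y < 3" for x y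
      using orth[OF that] three[OF that(1)] three[OF that(2)] unfolding D_def sum3 by auto
  qed
qed

end

section \<open>From the characteristic polynomials to the spectra, and the equivalences\<close>

text \<open>The order of \<open>S\<close> is not given and comes from the degree. The exceptional
  integer roots \<open>rs\<close> are listed first; of the others, \<open>sqrt m\<close> and
  \<open>- sqrt m\<close>, only the square is ever used, which keeps the irrational values out of
  the later arguments.\<close>

lemma seidel_spectral_decomposition:
  fixes S :: "int mat" and t k :: nat
  assumes S: "symmetric_seidel_mat S"
    and cp: "char_poly S = (\<Prod>r \<leftarrow> rs. [:- r, 1:]) * [:-(4 * int t + 1), 0, 1:] ^ k"
    and n: "n = length rs + 2 * k"
  shows "S \<in> carrier_mat n n" "seidel_fun n (\<lambda>i j. S $$ (i,j))"
    "\<exists>U e. spectral_decomposition n (\<lambda>i j. S $$ (i,j)) U e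
      \<and> (\<forall>i < length rs. e i = real_of_int (rs ! i))
      \<and> (\<forall>i < n. length rs \<le> i \<longrightarrow> e i * e i = real (4 * t + 1))"
proof -
  define s where "s = sqrt (real (4 * t + 1))"
  have s: "s * s = real (4 * t + 1)" unfolding s_def by simp
  have Sd: "S \<in> carrier_mat (dim_row S) (dim_row S)"
    using S unfolding symmetric_seidel_mat_def seidel_mat_def by auto
  let ?p = "\<Prod>r \<leftarrow> rs. [:- r, 1:]" and ?q = "[:-(4 * int t + 1), 0, 1:] ^ k"
  have "monic ?p" by (rule monic_prod_list) auto
  hence "?p \<noteq> 0" by auto
  moreover have "?q \<noteq> 0" by simp
  ultimately have "degree (?p * ?q) = degree ?p + degree ?q" by (rule degree_mult_eq)
  also have "degree ?p = length rs" by (rule degree_linear_factors)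
  also have "degree ?q = 2 * k" by (simp add: degree_power_eq)
  finally have "degree (char_poly S) = n" unfolding cp n .
  hence dim: "dim_row S = n" using degree_monic_char_poly[OF Sd] by simp
  show Sc: "S \<in> carrier_mat n n" using Sd unfolding dim .
  show "seidel_fun n (\<lambda>i j. S $$ (i,j))" using symmetric_seidel_mat_iff[OF Sc] S by simp
  define es where "es = map real_of_int rs @ replicate k s @ replicate k (-s)"
  have rs: "map_poly real_of_int (\<Prod>r \<leftarrow> rs. [:- r, 1:]) = (\<Prod>e \<leftarrow> map real_of_int rs. [:- e, 1:])"
    by (induction rs) (simp_all add: hom_distribs)
  have z: "map_poly real_of_int [:-(4 * int t + 1), 0, 1:] = [:- s, 1:] * [:s, 1:]"
    using s by (simp add: hom_distribs)
  have "map_poly real_of_int (char_poly S) = (\<Prod>e \<leftarrow> map real_of_int rs. [:- e, 1:]) * ([:- s, 1:] * [:s, 1:]) ^ k"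
    unfolding cp of_int_poly_hom.hom_mult of_int_poly_hom.hom_power rs z ..
  also have "\<dots> = (\<Prod>e \<leftarrow> es. [:- e, 1:])"
    unfolding es_def power_mult_distrib by (simp add: mult.assoc prod_list_replicate)
  finally have "map_poly real_of_int (char_poly S) = (\<Prod>e \<leftarrow> es. [:- e, 1:])" .
  moreover have "transpose_mat S = S" using S unfolding symmetric_seidel_mat_def by simp
  ultimately obtain U where U: "spectral_decomposition n (\<lambda>i j. S $$ (i,j)) U (\<lambda>k. es ! k)"
    using spectral_decomposition_exists[OF Sc] by blast
  have "es ! i * es ! i = real (4 * t + 1)" if "i < n" "length rs \<le> i" for i
  proof -
    have "es ! i = s \<or> es ! i = - s" using that n unfolding es_def by (auto simp: nth_append)
    thus ?thesis using s by auto
  qed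
  moreover have "es ! i = real_of_int (rs ! i)" if "i < length rs" for i
    using that unfolding es_def by (simp add: nth_append)
  ultimately show "\<exists>U e. spectral_decomposition n (\<lambda>i j. S $$ (i,j)) U e
      \<and> (\<forall>i < length rs. e i = real_of_int (rs ! i))
      \<and> (\<forall>i < n. length rs \<le> i \<longrightarrow> e i * e i = real (4 * t + 1))"
    using U by blast
qed

lemma full_seidel_square:
  fixes S :: "int mat"
  assumes S: "symmetric_seidel_mat S" and cp: "char_poly S = [:-(4 * int t + 1), 0, 1:] ^ (2 * t + 1)"
    and n: "n = 4 * t + 2"
  shows "S \<in> carrier_mat n n" "S * S = (4 * int t + 1) \<cdot>\<^sub>m 1\<^sub>m n"
proof -
  have cp': "char_poly S = (\<Prod>r \<leftarrow> []. [:- r, 1:]) * [:-(4 * int t + 1), 0, 1:] ^ (2 * t + 1)"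
    using cp by simp
  have n': "n = length ([] :: int list) + 2 * (2 * t + 1)" using n by simp
  note sd = seidel_spectral_decomposition[OF S cp' n']
  show Sn: "S \<in> carrier_mat n n" by (rule sd(1))
  obtain U e where U: "spectral_decomposition n (\<lambda>i j. S $$ (i,j)) U e"
    and e: "\<forall>i<n. e i * e i = real (4 * t + 1)" using sd(3) by auto
  interpret spectral_decomposition n "\<lambda>i j. S $$ (i,j)" U e by (rule U)
  show "S * S = (4 * int t + 1) \<cdot>\<^sub>m 1\<^sub>m n"
  proof (rule eq_matI)
    fix i j assume "i < dim_row ((4 * int t + 1) \<cdot>\<^sub>m 1\<^sub>m n)" "j < dim_col ((4 * int t + 1) \<cdot>\<^sub>m 1\<^sub>m n)"
    hence ij: "i < n" "j < n" by auto
    have "defect (4 * int t + 1) n (\<lambda>i j. S $$ (i,j)) i j = 0"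
      by (rule represents_eqI[OF represents_defect represents_zero _ ij]) (use e in auto)
    moreover have "(S * S) $$ (i,j) = (\<Sum>k<n. S $$ (i,k) * S $$ (k,j))"
      using Sn ij by (simp add: scalar_prod_def lessThan_atLeast0)
    ultimately have "(S * S) $$ (i,j) = (if i = j then 4 * int t + 1 else 0)"
      unfolding defect_def by linarith
    thus "(S * S) $$ (i,j) = ((4 * int t + 1) \<cdot>\<^sub>m 1\<^sub>m n) $$ (i,j)" using ij by simp
  qed (use Sn in auto)
qed

theorem theorem4p3:
  fixes t :: nat and x :: "int poly"
  assumes "t > 0" and "x = [:0, 1:]"
  shows "
      ((\<exists>S. symmetric_seidel_mat S \<and> char_poly S = (x^2 - of_nat (4 * t) - 1) ^ (2 * t + 1))
        \<longleftrightarrow> (\<exists>S. symmetric_seidel_mat S \<and> char_poly S = x * (x^2 - of_nat (4 * t) - 1) ^ (2 * t))) \<and>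
      ((\<exists>S. symmetric_seidel_mat S \<and> char_poly S = x * (x^2 - of_nat (4 * t) - 1) ^ (2 * t))
        \<longleftrightarrow> (\<exists>S. symmetric_seidel_mat S \<and> char_poly S = (x^2 - 1) * (x^2 - of_nat (4 * t) - 1) ^ (2 * t - 1))) \<and>
      ((\<exists>S. symmetric_seidel_mat S \<and> char_poly S = (x^2 - 1) * (x^2 - of_nat (4 * t) - 1) ^ (2 * t - 1))
        \<longleftrightarrow> (\<exists>S. symmetric_seidel_mat S \<and> char_poly S = (x - 2) * (x + 1)^2 * (x^2 - of_nat (4 * t) - 1) ^ (2 * (t - 1))))"
proof -
  note t = assms(1)
  let ?m = "4 * int t + 1"
  define z where "z = [:-?m, 0, 1:]"
  \<comment> \<open>All four conditions take the form \<open>A k p\<close> with \<open>p\<close> the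
    exceptional factor; each of (b), (c), (d) is compared with (a), which is
    \<open>A (2 * t + 1) 1\<close>.\<close>
  define A where "A k p \<longleftrightarrow> (\<exists>S. symmetric_seidel_mat S \<and> char_poly S = p * z ^ k)" for k and p :: "int poly"
  have z0: "z \<noteq> 0" unfolding z_def by simp
  have z: "x^2 - of_nat (4 * t) - 1 = z"
    unfolding z_def assms(2) by (simp add: power2_eq_square of_nat_poly one_pCons)
  have p2: "x^2 - 1 = [:-1, 0, 1:]" unfolding assms(2) by (simp add: power2_eq_square one_pCons)
  have p3: "(x - 2) * (x + 1)^2 = [:-2, -3, 0, 1:]"
    unfolding assms(2) by (simp add: power2_eq_square one_pCons numeral_poly)
  \<comment> \<open>Deleting the last \<open>k\<close> vertices: \<open>z ^ k\<close> is cancelled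
    from the complementary minor formula, and the polynomial of the negated corner remains as
    exceptional factor.\<close>
  have down: "\<exists>B. symmetric_seidel_mat B \<and>
      char_poly B = char_poly (mat k k (\<lambda>(i,j). - S $$ (4 * t + 2 - k + i, 4 * t + 2 - k + j))) * z ^ (2 * t + 1 - k)"
    if S: "symmetric_seidel_mat S" "char_poly S = z ^ (2 * t + 1)" and k: "k \<le> 2 * t + 1" for S k
  proof -
    let ?n = "4 * t + 2 - k"
    have nk: "4 * t + 2 = ?n + k" using k by simp
    note sq = full_seidel_square[OF S(1) S(2)[unfolded z_def] nk[symmetric]]
    obtain B where B: "symmetric_seidel_mat B"
      "char_poly S * char_poly (mat k k (\<lambda>(i,j). - S $$ (?n + i, ?n + j))) = char_poly B * z ^ k"
      using seidel_restriction[OF sq(1) S(1) sq(2), folded z_def] by blast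
    have "z ^ (2 * t + 1) = z ^ (2 * t + 1 - k) * z ^ k" using k by (simp flip: power_add)
    hence "z ^ k * (char_poly (mat k k (\<lambda>(i,j). - S $$ (?n + i, ?n + j))) * z ^ (2 * t + 1 - k)) = z ^ k * char_poly B"
      using B(2) S(2) by (simp add: mult_ac)
    thus ?thesis using B(1) z0 by auto
  qed
  have corner: "seidel_fun k (\<lambda>i j. S $$ (4 * t + 2 - k + i, 4 * t + 2 - k + j))"
    if S: "symmetric_seidel_mat S" "char_poly S = z ^ (2 * t + 1)" and k: "k \<le> 4 * t + 2" for S k
    using symmetric_seidel_mat_iff[OF full_seidel_square(1)[OF S(1) S(2)[unfolded z_def] refl]] S(1) k
    unfolding seidel_fun_def by auto
  \<comment> \<open>The polynomial \<open>q\<close> of the negated new corner equals the exceptional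
    factor of \<open>B\<close>, so it cancels and leaves a pure power of \<open>z\<close>.\<close>
  have up: "A (2 * t + 1) 1"
    if ex: "\<exists>S. symmetric_seidel_mat S \<and> char_poly S * q = char_poly B * z ^ k"
    and B: "char_poly B = q * z ^ (2 * t + 1 - k)" and q: "q \<noteq> 0" and k: "k \<le> 2 * t + 1" for B q k
  proof -
    obtain S where S: "symmetric_seidel_mat S" "char_poly S * q = char_poly B * z ^ k" using ex by blast
    have "z ^ (2 * t + 1) = z ^ (2 * t + 1 - k) * z ^ k" using k by (simp flip: power_add)
    hence "q * char_poly S = q * z ^ (2 * t + 1)" using S(2) B by (simp add: mult_ac)
    thus ?thesis using S(1) q unfolding A_def by auto
  qed
  have ab: "A (2 * t) [:0, 1:]" if "A (2 * t + 1) 1"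
  proof -
    obtain S where S: "symmetric_seidel_mat S" "char_poly S = z ^ (2 * t + 1)" using \<open>A (2 * t + 1) 1\<close> unfolding A_def by auto
    show ?thesis using down[OF S, of 1] char_poly_seidel_one[OF corner[OF S, of 1]] unfolding A_def by auto
  qed
  have ac: "A (2 * t - 1) [:-1, 0, 1:]" if "A (2 * t + 1) 1"
  proof -
    obtain S where S: "symmetric_seidel_mat S" "char_poly S = z ^ (2 * t + 1)" using \<open>A (2 * t + 1) 1\<close> unfolding A_def by auto
    show ?thesis using down[OF S, of 2] char_poly_seidel_two[OF corner[OF S, of 2]] t unfolding A_def by auto
  qed
  have ad: "A (2 * (t - 1)) [:-2, -3, 0, 1:]" if "A (2 * t + 1) 1"
  proof -
    \<comment> \<open>The product of the three entries above the diagonal in the last 3 by 3 corner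
      must be -1; replacing \<open>S\<close> by \<open>- S\<close> flips it.\<close>
    have *: ?thesis if S: "symmetric_seidel_mat S" "char_poly S = z ^ (2 * t + 1)"
      and neg: "S $$ (4 * t - 1, 4 * t) * S $$ (4 * t - 1, 4 * t + 1) * S $$ (4 * t, 4 * t + 1) = -1" for S
    proof -
      have idx: "4 * t + 2 - 3 = 4 * t - 1" "4 * t - 1 + 1 = 4 * t" "4 * t - 1 + 2 = 4 * t + 1" "2 * t + 1 - 3 = 2 * (t - 1)"
        using t by auto
      have "char_poly (mat 3 3 (\<lambda>(i,j). - S $$ (4 * t + 2 - 3 + i, 4 * t + 2 - 3 + j))) = [:-2, -3, 0, 1:]"
        using char_poly_seidel_three[OF corner[OF S, of 3]] neg t unfolding idx(1) add_0_right idx(2,3) by simp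
      thus ?thesis using down[OF S, of 3] t unfolding A_def idx(4) by auto
    qed
    obtain S where S: "symmetric_seidel_mat S" "char_poly S = z ^ (2 * t + 1)" using \<open>A (2 * t + 1) 1\<close> unfolding A_def by auto
    let ?s = "S $$ (4 * t - 1, 4 * t) * S $$ (4 * t - 1, 4 * t + 1) * S $$ (4 * t, 4 * t + 1)"
    note sq = full_seidel_square[OF S(1) S(2)[unfolded z_def] refl]
    have Sf: "seidel_fun (4 * t + 2) (\<lambda>i j. S $$ (i,j))" using symmetric_seidel_mat_iff[OF sq(1)] S(1) by simp
    have idx: "4 * t - 1 < 4 * t + 2" "4 * t < 4 * t + 2" "4 * t + 1 < 4 * t + 2"
      "4 * t - 1 \<noteq> 4 * t" "4 * t - 1 \<noteq> 4 * t + 1" "4 * t \<noteq> 4 * t + 1" using t by auto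
    have "?s \<in> {1,-1}"
      using seidel_funD(3)[OF Sf idx(1,2,4)] seidel_funD(3)[OF Sf idx(1,3,5)] seidel_funD(3)[OF Sf idx(2,3,6)]
      by (elim insertE emptyE) simp_all
    then consider "?s = -1" | "?s = 1" by blast
    thus ?thesis
    proof cases
      case 1
      thus ?thesis by (rule *[OF S])
    next
      case 2
      have nS: "- S \<in> carrier_mat (4 * t + 2) (4 * t + 2)" using sq(1) by simp
      have neg: "(- S) $$ (i,j) = - S $$ (i,j)" if "i < 4 * t + 2" "j < 4 * t + 2" for i j
        using sq(1) that by simp
      have "symmetric_seidel_mat (- S)"
        unfolding symmetric_seidel_mat_iff[OF nS] seidel_fun_def
      proof (intro conjI allI impI)
        fix i j assume ij: "i < 4 * t + 2" "j < 4 * t + 2"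
        show "(- S) $$ (i,j) = (- S) $$ (j,i)" using seidel_funD(2)[OF Sf ij] neg ij by simp
        show "(- S) $$ (i,j) \<in> {1,-1}" if "i \<noteq> j" using seidel_funD(3)[OF Sf ij that] neg ij by auto
      qed (use neg seidel_funD(1)[OF Sf] in simp)
      \<comment> \<open>The two polynomials multiply to \<open>z ^ (4 * t + 2)\<close>, of which
        \<open>S\<close> accounts for exactly half.\<close>
      moreover have "char_poly (- S) = z ^ (2 * t + 1)"
      proof -
        have "4 * t + 2 = (2 * t + 1) + (2 * t + 1)" by simp
        hence "z ^ (2 * t + 1) * char_poly (- S) = z ^ (2 * t + 1) * z ^ (2 * t + 1)"
          using char_poly_times_uminus[OF sq, folded z_def] S(2) by (simp only: power_add)
        thus ?thesis by (rule mult_left_cancel[THEN iffD1, OF power_not_zero[OF z0]])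
      qed
      moreover have "(- S) $$ (4 * t - 1, 4 * t) * (- S) $$ (4 * t - 1, 4 * t + 1) * (- S) $$ (4 * t, 4 * t + 1) = -1"
        using 2 unfolding neg[OF idx(1,2)] neg[OF idx(1,3)] neg[OF idx(2,3)] by simp
      ultimately show ?thesis by (rule *)
    qed
  qed
  have ba: "A (2 * t + 1) 1" if "A (2 * t) [:0, 1:]"
  proof -
    obtain B where B: "symmetric_seidel_mat B" "char_poly B = [:0,1:] * z ^ (2 * t)"
      using \<open>A (2 * t) [:0, 1:]\<close> unfolding A_def by auto
    have cp: "char_poly B = (\<Prod>r \<leftarrow> [0]. [:- r, 1:]) * [:-?m, 0, 1:] ^ (2 * t)" using B(2) unfolding z_def by simp
    define n where "n = 4 * t + 1"
    have "n = length [0 :: int] + 2 * (2 * t)" unfolding n_def by simp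
    note sd = seidel_spectral_decomposition[OF B(1) cp this]
    note Bc = sd(1) and Bf = sd(2)
    obtain U e where U: "spectral_decomposition n (\<lambda>i j. B $$ (i,j)) U e"
      and e0: "\<forall>i<1. e i = real_of_int ([0] ! i)" and e: "\<forall>i<n. 1 \<le> i \<longrightarrow> e i * e i = real (4 * t + 1)"
      using sd(3) by auto
    have spec: "e k = 0 \<or> e k * e k = real (4 * t + 1)" if "k < n" for k
      using e0 e that by (cases "k = 0") auto
    interpret spectral_decomposition n "\<lambda>i j. B $$ (i,j)" U e by (rule U)
    obtain v where v: "\<And>i. i < n \<Longrightarrow> v i \<in> {1, -1}"
      "\<And>i j. \<lbrakk>i < n; j < n\<rbrakk> \<Longrightarrow> defect ?m n (\<lambda>i j. B $$ (i,j)) i j = v i * v j"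
      "\<And>i. i < n \<Longrightarrow> (\<Sum>l<n. B $$ (i,l) * v l) = 0" "(\<Sum>i<n. v i * v i) = ?m"
      by (rule add_one_vertex[OF Bf n_def spec], assumption) (rule that)
    have D: "seidel_fun 1 (\<lambda>_ _. 0)" unfolding seidel_fun_def by simp
    have "\<exists>S. symmetric_seidel_mat S \<and> char_poly S * char_poly (mat 1 1 (\<lambda>(x,y). - 0)) = char_poly B * z ^ 1"
      unfolding z_def by (rule seidel_extension[OF Bc Bf D, of "\<lambda>i _. v i"]) (use v in simp_all)
    thus ?thesis using char_poly_seidel_one[OF D] B(2) by (intro up[of "[:0,1:]" B 1]) simp_all
  qed
  have ca: "A (2 * t + 1) 1" if "A (2 * t - 1) [:-1, 0, 1:]"
  proof -
    obtain B where B: "symmetric_seidel_mat B" "char_poly B = [:-1,0,1:] * z ^ (2 * t - 1)"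
      using \<open>A (2 * t - 1) [:-1, 0, 1:]\<close> unfolding A_def by auto
    have cp: "char_poly B = (\<Prod>r \<leftarrow> [1,-1]. [:- r, 1:]) * [:-?m, 0, 1:] ^ (2 * t - 1)" using B(2) unfolding z_def by simp
    define n where "n = 4 * t"
    have "n = length [1, -1 :: int] + 2 * (2 * t - 1)" unfolding n_def using t by simp
    note sd = seidel_spectral_decomposition[OF B(1) cp this]
    note Bc = sd(1) and Bf = sd(2)
    obtain U e where U: "spectral_decomposition n (\<lambda>i j. B $$ (i,j)) U e"
      and e0: "\<forall>i < length [1, -1 :: int]. e i = real_of_int ([1,-1] ! i)"
      and e: "\<forall>i<n. length [1, -1 :: int] \<le> i \<longrightarrow> e i * e i = real (4 * t + 1)"
      using sd(3) by blast
    have e01: "e 0 = 1" "e 1 = -1" using e0 by auto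
    have spec: "e k * e k = real (4 * t + 1)" if "k < n" "k \<noteq> 0" "k \<noteq> 1" for k
      using e that by simp
    interpret spectral_decomposition n "\<lambda>i j. B $$ (i,j)" U e by (rule U)
    obtain C D where CD: "seidel_fun 2 D" "\<And>i x. \<lbrakk>i < n; x < 2\<rbrakk> \<Longrightarrow> C i x \<in> {1, -1}"
      "\<And>i j. \<lbrakk>i < n; j < n\<rbrakk> \<Longrightarrow> defect ?m n (\<lambda>i j. B $$ (i,j)) i j = (\<Sum>x<2. C i x * C j x)"
      "\<And>i x. \<lbrakk>i < n; x < 2\<rbrakk> \<Longrightarrow> (\<Sum>l<n. B $$ (i,l) * C l x) = - (\<Sum>y<2. C i y * D y x)"
      "\<And>x y. \<lbrakk>x < 2; y < 2\<rbrakk> \<Longrightarrow> (\<Sum>i<n. C i x * C i y) + (\<Sum>z<2. D x z * D z y) = (if x = y then ?m else 0)"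
      by (rule add_two_vertices[OF Bf n_def t e01 spec], assumption+) (rule that)
    have "\<exists>S. symmetric_seidel_mat S \<and> char_poly S * char_poly (mat 2 2 (\<lambda>(x,y). - D x y)) = char_poly B * z ^ 2"
      unfolding z_def by (rule seidel_extension[OF Bc Bf CD], assumption+)
    thus ?thesis unfolding char_poly_seidel_two[OF CD(1)]
      using B(2) t by (intro up[of "[:-1,0,1:]" B 2]) simp_all
  qed
  have da: "A (2 * t + 1) 1" if "A (2 * (t - 1)) [:-2, -3, 0, 1:]"
  proof -
    obtain B where B: "symmetric_seidel_mat B" "char_poly B = [:-2,-3,0,1:] * z ^ (2 * (t - 1))"
      using \<open>A (2 * (t - 1)) [:-2, -3, 0, 1:]\<close> unfolding A_def by auto
    have cp: "char_poly B = (\<Prod>r \<leftarrow> [2,-1,-1]. [:- r, 1:]) * [:-?m, 0, 1:] ^ (2 * (t - 1))" using B(2) unfolding z_def by simp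
    define n where "n = 4 * t - 1"
    have "n = length [2, -1, -1 :: int] + 2 * (2 * (t - 1))" unfolding n_def using t by simp
    note sd = seidel_spectral_decomposition[OF B(1) cp this]
    note Bc = sd(1) and Bf = sd(2)
    obtain U e where U: "spectral_decomposition n (\<lambda>i j. B $$ (i,j)) U e"
      and e0: "\<forall>i < length [2, -1, -1 :: int]. e i = real_of_int ([2,-1,-1] ! i)"
      and e: "\<forall>i<n. length [2, -1, -1 :: int] \<le> i \<longrightarrow> e i * e i = real (4 * t + 1)"
      using sd(3) by blast
    have e012: "e 0 = 2" "e 1 = -1" "e 2 = -1" using e0 by auto
    have n4: "n + 1 = 4 * t" unfolding n_def using t by simp
    have spec: "e k = -1 \<or> e k * e k = real (4 * t + 1)" if "k < n" "k \<noteq> 0" for k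
    proof (cases "k = 1 \<or> k = 2")
      case True
      thus ?thesis using e012 by auto
    next
      case False
      hence "length [2, -1, -1 :: int] \<le> k" using that by simp
      thus ?thesis using e that by blast
    qed
    interpret spectral_decomposition n "\<lambda>i j. B $$ (i,j)" U e by (rule U)
    let ?D = "\<lambda>x y :: nat. if x = y then 0 else - 1 :: int"
    obtain C :: "nat \<Rightarrow> nat \<Rightarrow> int" where C: "\<And>i x. \<lbrakk>i < n; x < 3\<rbrakk> \<Longrightarrow> C i x \<in> {1, -1}"
      "\<And>i j. \<lbrakk>i < n; j < n\<rbrakk> \<Longrightarrow> defect ?m n (\<lambda>i j. B $$ (i,j)) i j = (\<Sum>x<3. C i x * C j x)"
      "\<And>i x. \<lbrakk>i < n; x < 3\<rbrakk> \<Longrightarrow> (\<Sum>l<n. B $$ (i,l) * C l x) = - (\<Sum>y<3. C i y * ?D y x)"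
      "\<And>x y. \<lbrakk>x < 3; y < 3\<rbrakk> \<Longrightarrow> (\<Sum>i<n. C i x * C i y) + (\<Sum>z<3. ?D x z * ?D z y) = (if x = y then ?m else 0)"
      by (rule add_three_vertices[OF Bf n4 t e012(1) spec], assumption+) (rule that)
    have D: "seidel_fun 3 ?D" unfolding seidel_fun_def by simp
    have "\<exists>S. symmetric_seidel_mat S \<and> char_poly S * char_poly (mat 3 3 (\<lambda>(x,y). - ?D x y)) = char_poly B * z ^ 3"
      unfolding z_def by (rule seidel_extension[OF Bc Bf D C], assumption+)
    \<comment> \<open>All three entries of the new corner are -1, so their product is -1 and the
      factor is \<open>(x - 2)(x + 1)^2\<close>, as in (d).\<close>
    moreover have "char_poly (mat 3 3 (\<lambda>(x,y). - ?D x y)) = [:-2,-3,0,1:]"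
      using char_poly_seidel_three[OF D] by simp
    moreover have "2 * t + 1 - 3 = 2 * (t - 1)" using t by simp
    ultimately show ?thesis
      using B(2) t by (intro up[of "[:-2,-3,0,1:]" B 3]) simp_all
  qed
  have "A (2 * t + 1) 1 \<longleftrightarrow> (\<exists>S. symmetric_seidel_mat S \<and> char_poly S = z ^ (2 * t + 1))"
    unfolding A_def by simp
  moreover have "A (2 * t) [:0, 1:] \<longleftrightarrow> A (2 * t + 1) 1" using ab ba by blast
  moreover have "A (2 * t - 1) [:-1, 0, 1:] \<longleftrightarrow> A (2 * t + 1) 1" using ac ca by blast
  moreover have "A (2 * (t - 1)) [:-2, -3, 0, 1:] \<longleftrightarrow> A (2 * t + 1) 1" using ad da by blast
  ultimately show ?thesis
    unfolding z p2 p3 unfolding assms(2) A_def by blast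
qed

end
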